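(* Let $\tau\in\mathbb{C}$ with $\mathrm{Im}(\tau)>0$, $q=e^{i\pi\tau}$, and let $z=\tfrac12+\alpha+\beta\tau$ with $(\alpha,\beta)\in\mathbb{R}^2$. Put $DN(z,\tau)=\frac{2K}{\pi}\,\mathrm{dn}(2Kz)$. If $|\beta|<\tfrac12$, then $$DN(z,\tau)=1+4\sum_{n=1}^{+\infty}\frac{q^n\cos(2n\pi z)}{1+q^{2n}}=1+2\sum_{n=1}^{+\infty}\frac{\cos(2n\pi z)}{\cos(n\pi\tau)},$$ and if $|\alpha|<\tfrac12$, then $$DN(z,\tau)=\frac{2}{\tau}\sum_{n=0}^{+\infty}\frac{(-1)^n\cos\left((n+\frac12)\pi(2z-1)/\tau\right)}{\sin\left((n+\frac12)\pi/\tau\right)}.$$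
   Context: The Jacobi functions are taken with parameter $\tau=iK'/K$ and nome $q=e^{i\pi\tau}$. Explicitly, with $q^s=e^{i\pi\tau s}$, let $\theta_1(v)=2\sum_{n\ge0}(-1)^nq^{(n+1/2)^2}\sin((2n+1)v)$, $\theta_2(v)=2\sum_{n\ge0}q^{(n+1/2)^2}\cos((2n+1)v)$, $\theta_3(v)=1+2\sum_{n\ge1}q^{n^2}\cos(2nv)$, $\theta_4(v)=1+2\sum_{n\ge1}(-1)^nq^{n^2}\cos(2nv)$, and $\theta_j=\theta_j(0)$. Then $k=\theta_2^2/\theta_3^2$, $k'=\theta_4^2/\theta_3^2$, $K=\frac{\pi}{2}\theta_3^2$, and $\mathrm{dn}(2Kz)=\frac{\theta_4}{\theta_3}\frac{\theta_3(\pi z)}{\theta_4(\pi z)}$. When $\tau$ is purely imaginary these are the classical Jacobi modulus, complete elliptic integral and function $\mathrm{dn}$. *)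

theory Defs
  imports "HOL-Analysis.Analysis"
begin

definition nome :: "complex \<Rightarrow> complex" where
  "nome \<tau> = exp (\<i> * of_real pi * \<tau>)"

(* The index is shifted (Suc n) because the sums start at 1.
   The series converge for every v when Im \<tau> > 0. *)
definition theta3 :: "complex \<Rightarrow> complex \<Rightarrow> complex" where
  "theta3 \<tau> v = 1 + 2 * (\<Sum>n. nome \<tau> ^ ((Suc n)\<^sup>2) * cos (2 * of_nat (Suc n) * v))"

definition theta4 :: "complex \<Rightarrow> complex \<Rightarrow> complex" where
  "theta4 \<tau> v = 1 + 2 * (\<Sum>n. (-1) ^ Suc n * nome \<tau> ^ ((Suc n)\<^sup>2) * cos (2 * of_nat (Suc n) * v))"

definition ell_K :: "complex \<Rightarrow> complex" where
  "ell_K \<tau> = of_real pi / 2 * (theta3 \<tau> 0)\<^sup>2"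

(* dn as a function of its usual argument u = 2 K z, so that pi * z = pi * u / (2 K). *)
definition jacobi_dn :: "complex \<Rightarrow> complex \<Rightarrow> complex" where
  "jacobi_dn \<tau> u =
     theta4 \<tau> 0 / theta3 \<tau> 0 *
     (theta3 \<tau> (of_real pi * (u / (2 * ell_K \<tau>))) / theta4 \<tau> (of_real pi * (u / (2 * ell_K \<tau>))))"

definition DN :: "complex \<Rightarrow> complex \<Rightarrow> complex" where
  "DN z \<tau> = 2 * ell_K \<tau> / of_real pi * jacobi_dn \<tau> (2 * ell_K \<tau> * z)"

end

theory Submission
  imports Defs
begin

text \<open>
  Put $w = e^{2 \pi i z}$ and $\Theta(q, w) = \sum_n q^{n^2} w^n$, so that dn is a constant times
  $\Theta(q, w) / \Theta(q, -w)$. Let $F(q, w) = \sum_n 2 w^n / (q^n + q^{-n})$. The Laurent coefficients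
  $c_N$ of $F(q, w) \Theta(q, -w)$ satisfy $c_{N+1} = q^{2N+1} c_N$, hence
  $F(q, w) \Theta(q, -w) = c_0 \Theta(q, w)$. The Landen relations
  $F(q, 1) + F(q, -1) = 2 F(q^2, 1)$ and $\Theta(q, 1)^2 + \Theta(q, -1)^2 = 2 \Theta(q^2, 1)^2$
  show that $F(q, 1) / \Theta(q, 1)^2$ is invariant under $q \mapsto q^2$; letting $q^{2^k} \to 0$ it
  equals 1, which determines $c_0$.

  For the second expansion, $F$ is up to a constant factor a sum over the points $p_{m,k} = z + m + (k + 1/2) \tau$ of
  $(-1)^k / p_{m,k}$. Replacing the terms by third differences in $k$ makes the double sum absolutely
  convergent; summing over $m$ first gives cotangents and hence $F$, summing over $k$ first gives
  $1 / \cos (\pi (z + m) / \tau)$, which expands geometrically. This settles $|\beta| < 1/2$; continuity in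
  $\beta$ and antiperiodicity under $z \mapsto z + \tau$ give the rest.
\<close>

section \<open>Unconditional sums over the integers\<close>

text \<open>The points z = -m - (k + 1/2) tau are the zeros of \<Theta>(q, -w), hence the candidates
  for poles of dn; the signs (-1)^k record dn(z + tau) = -dn(z). Two obstacles shape the argument.
  The alternating sum over the points p is not absolutely convergent, so its two orders of summation
  cannot be compared directly; a third difference decays like |p|^(-4), which splits into one
  inverse square for each lattice direction. Moreover F converges only for |\<beta>| < 1/2, and the
  translates of this open strip by multiples of tau miss the lines \<beta> = k + 1/2, which contain
  the zeros of the denominator. On these lines the identity is reached by continuity after clearing
  denominators, and the division is justified separately. No theory of elliptic functions enters:
  the constant of proportionality comes from comparing Laurent coefficients and from the
  degeneration q -> 0.\<close>

lemma abs_summable_product_bound: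
  fixes f :: "'a \<Rightarrow> 'b \<Rightarrow> complex" and A :: "'a \<Rightarrow> real" and B :: "'b \<Rightarrow> real"
  assumes A: "A summable_on UNIV" and B: "B summable_on UNIV"
    and bound: "\<And>m n. norm (f m n) \<le> A m * B n"
  shows "(\<lambda>(m, n). f m n) summable_on UNIV"
proof -
  have A': "(\<lambda>m. \<bar>A m\<bar>) summable_on UNIV" and B': "(\<lambda>n. \<bar>B n\<bar>) summable_on UNIV"
    using A B summable_on_iff_abs_summable_on_real[of A] summable_on_iff_abs_summable_on_real[of B]
    by simp_all
  have "(\<lambda>(m, n). \<bar>A m\<bar> * \<bar>B n\<bar>) summable_on (UNIV \<times> UNIV)"
  proof (rule summable_on_SigmaI)
    show "((\<lambda>n. case (m, n) of (m, n) \<Rightarrow> \<bar>A m\<bar> * \<bar>B n\<bar>) has_sum \<bar>A m\<bar> * infsum (\<lambda>n. \<bar>B n\<bar>) UNIV) UNIV" for m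
      using B' by (simp add: has_sum_cmult_right)
    show "(\<lambda>m. \<bar>A m\<bar> * infsum (\<lambda>n. \<bar>B n\<bar>) UNIV) summable_on UNIV"
      using A' by (rule summable_on_cmult_left)
  qed auto
  moreover have "norm ((\<lambda>(m, n). f m n) x) \<le> (\<lambda>(m, n). \<bar>A m\<bar> * \<bar>B n\<bar>) x" for x
    using order_trans[OF bound abs_ge_self] by (cases x) (auto simp: abs_mult)
  ultimately have "(\<lambda>x. norm ((\<lambda>(m, n). f m n) x)) summable_on UNIV"
    by (intro Infinite_Sum.abs_summable_on_comparison_test'[where g = "\<lambda>(m, n). \<bar>A m\<bar> * \<bar>B n\<bar>"]) auto
  then show ?thesis
    by (rule abs_summable_summable)
qed

text \<open>A majorant that factors into a summable function of each index makes the double family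
  absolutely summable, so both iterated sums equal its unconditional sum. Each of the three
  exchanges of summation below is arranged to have such a majorant.\<close>

lemma has_sum_double_swap:
  fixes f :: "'a \<Rightarrow> 'b \<Rightarrow> complex" and A :: "'a \<Rightarrow> real" and B :: "'b \<Rightarrow> real"
  assumes A: "A summable_on UNIV" and B: "B summable_on UNIV"
    and bound: "\<And>m n. norm (f m n) \<le> A m * B n"
    and g: "\<And>m. ((\<lambda>n. f m n) has_sum g m) UNIV"
    and h: "\<And>n. ((\<lambda>m. f m n) has_sum h n) UNIV"
  obtains S where "(g has_sum S) UNIV" "(h has_sum S) UNIV"
proof -
  have "(\<lambda>(m, n). f m n) summable_on (UNIV \<times> UNIV)"
    using abs_summable_product_bound[OF A B bound] by simp
  then obtain S where S: "((\<lambda>(m, n). f m n) has_sum S) (UNIV \<times> UNIV)"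
    by (auto simp: summable_on_def)
  have 1: "(g has_sum S) UNIV"
    by (rule has_sum_Sigma'[OF S]) (use g in auto)
  have "((\<lambda>(n, m). f m n) has_sum S) (UNIV \<times> UNIV)"
    using S by (subst (asm) has_sum_swap) simp
  then have 2: "(h has_sum S) UNIV"
    by (rule has_sum_Sigma') (use h in auto)
  show ?thesis
    using that[OF 1 2] .
qed

lemma has_sum_int_split:
  fixes f :: "int \<Rightarrow> 'a::topological_comm_monoid_add"
  assumes "((\<lambda>n::nat. f (int n)) has_sum S) UNIV" "((\<lambda>n::nat. f (- 1 - int n)) has_sum T) UNIV"
  shows "(f has_sum S + T) UNIV"
proof -
  have 1: "(f has_sum S) {0..}"
    using assms(1) by (subst has_sum_reindex_bij_witness[of _ int nat]) auto
  have 2: "(f has_sum T) {..-1}"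
    using assms(2)
    by (subst has_sum_reindex_bij_witness[of _ "\<lambda>n. -1 - int n" "\<lambda>k. nat (-1 - k)"]) auto
  have "(f has_sum S + T) ({0..} \<union> {..-1})"
    using 1 2 by (rule has_sum_Un_disjoint) auto
  moreover have "({0..} \<union> {..-1}) = (UNIV :: int set)"
    by auto
  ultimately show ?thesis by simp
qed

text \<open>Pairing n with -n is what turns the bilateral series in w into the one-sided cosine
  series of the theta functions and of dn.\<close>

lemma has_sum_int_imp_nat:
  fixes f :: "int \<Rightarrow> complex"
  assumes "(f has_sum S) UNIV"
  shows "((\<lambda>n. f (int (Suc n)) + f (- int (Suc n))) has_sum S - f 0) UNIV"
proof -
  have f: "f summable_on UNIV" using assms by (auto simp: summable_on_def)
  have pos: "(\<lambda>n::nat. f (int n)) summable_on UNIV"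
    using summable_on_subset_banach[OF f, of "{0..}"]
    by (subst summable_on_reindex_bij_witness[of _ nat int "{0..}" f]) auto
  have neg: "(\<lambda>n::nat. f (- 1 - int n)) summable_on UNIV"
    using summable_on_subset_banach[OF f, of "{..-1}"]
    by (subst summable_on_reindex_bij_witness[of _ "\<lambda>k. nat (-1 - k)" "\<lambda>n. -1 - int n" "{..-1}" f]) auto
  obtain P N where P: "((\<lambda>n::nat. f (int n)) has_sum P) UNIV"
    and N: "((\<lambda>n::nat. f (- 1 - int n)) has_sum N) UNIV"
    using pos neg by (auto simp: summable_on_def)
  have S: "S = P + N"
    using has_sum_int_split[OF P N] assms has_sum_unique by blast
  have "((\<lambda>n::nat. f (int (Suc n))) has_sum P - f 0) UNIV"
  proof -
    have "((\<lambda>n::nat. f (int n)) has_sum P - f 0) (UNIV - {0})"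
      using has_sum_Diff[OF P has_sum_finite[of "{0}"]] by simp
    then show ?thesis
      by (subst has_sum_reindex_bij_witness[of _ "\<lambda>n. n - 1" Suc "UNIV - {0}" "\<lambda>n. f (int n)"]) auto
  qed
  from has_sum_add[OF this N] S show ?thesis
    by (simp add: algebra_simps)
qed

lemma has_sum_int_even_odd:
  fixes f :: "int \<Rightarrow> complex"
  assumes "(f has_sum S) UNIV"
  obtains P Q where "((\<lambda>j. f (2 * j)) has_sum P) UNIV" "((\<lambda>j. f (2 * j + 1)) has_sum Q) UNIV" "S = P + Q"
proof -
  have f: "f summable_on UNIV" using assms by (auto simp: summable_on_def)
  obtain P Q where P: "(f has_sum P) {k. even k}" and Q: "(f has_sum Q) {k. odd k}"
    using summable_on_subset_banach[OF f, of "{k. even k}"]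
      summable_on_subset_banach[OF f, of "{k. odd k}"] by (auto simp: summable_on_def)
  have "(f has_sum P + Q) ({k. even k} \<union> {k. odd k})"
    using P Q by (rule has_sum_Un_disjoint) auto
  moreover have "{k. even k} \<union> {k. odd k} = (UNIV :: int set)" by auto
  ultimately have "S = P + Q"
    using assms has_sum_unique by metis
  moreover have "((\<lambda>j. f (2 * j)) has_sum P) UNIV"
    using P by (subst has_sum_reindex_bij_witness[of _ "\<lambda>k. k div 2" "\<lambda>j. 2 * j" "{k. even k}" f]) auto
  moreover have "((\<lambda>j. f (2 * j + 1)) has_sum Q) UNIV"
    using Q by (subst has_sum_reindex_bij_witness[of _ "\<lambda>k. k div 2" "\<lambda>j. 2 * j + 1" "{k. odd k}" f]) auto
  ultimately show ?thesis using that by blast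
qed

lemma has_sum_minus:
  fixes f g :: "'a \<Rightarrow> complex"
  assumes "(f has_sum S) A" "(g has_sum T) A"
  shows "((\<lambda>x. f x - g x) has_sum S - T) A"
  using has_sum_add[OF assms(1), of "\<lambda>x. - g x" "- T"] assms(2) by (simp add: has_sum_uminus)

lemma has_sum_int_shift:
  fixes f :: "int \<Rightarrow> complex"
  shows "((\<lambda>k. f (k + c)) has_sum S) UNIV \<longleftrightarrow> (f has_sum S) UNIV"
  by (rule has_sum_reindex_bij_witness[of _ "\<lambda>k. k - c" "\<lambda>k. k + c"]) auto

lemma has_sum_int_uminus:
  fixes f :: "int \<Rightarrow> complex"
  shows "((\<lambda>k. f (c - k)) has_sum S) UNIV \<longleftrightarrow> (f has_sum S) UNIV"
  by (rule has_sum_reindex_bij_witness[of _ "\<lambda>k. c - k" "\<lambda>k. c - k"]) auto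

section \<open>Theta series\<close>

lemma has_sum_product_pair:
  fixes a :: "'a \<Rightarrow> complex" and b :: "'b \<Rightarrow> complex"
  assumes a: "(a has_sum P) UNIV" and b: "(b has_sum Q) UNIV"
  shows "((\<lambda>(n, m). a n * b m) has_sum P * Q) (UNIV \<times> UNIV)"
proof (rule has_sum_SigmaI)
  show "((\<lambda>m. case (n, m) of (n, m) \<Rightarrow> a n * b m) has_sum a n * Q) UNIV" for n
    using b by (simp add: has_sum_cmult_right)
  show "((\<lambda>n. a n * Q) has_sum P * Q) UNIV"
    using a by (rule has_sum_cmult_left)
  have "(\<lambda>n. norm (a n)) summable_on UNIV" "(\<lambda>m. norm (b m)) summable_on UNIV"
    using a b by (auto dest!: has_sum_imp_summable simp flip: summable_on_iff_abs_summable_on_complex)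
  then show "(\<lambda>(n, m). a n * b m) summable_on UNIV \<times> UNIV"
    using abs_summable_product_bound[of "\<lambda>n. norm (a n)" "\<lambda>m. norm (b m)" "\<lambda>n m. a n * b m"]
    by (simp add: norm_mult)
qed

text \<open>Cauchy product for Laurent series: the absolutely summable double family is resummed
  along the diagonals n + m = N. The convergence of each diagonal, assumed here, is supplied by the
  next lemma through the same reindexing.\<close>

lemma has_sum_int_convolution:
  fixes a b :: "int \<Rightarrow> complex"
  assumes "(a has_sum P) UNIV" "(b has_sum Q) UNIV"
    and c: "\<And>N. ((\<lambda>m. a (N - m) * b m) has_sum c N) UNIV"
  shows "(c has_sum P * Q) UNIV"
proof (rule has_sum_Sigma')
  show "((\<lambda>(N, m). a (N - m) * b m) has_sum P * Q) (UNIV \<times> UNIV)"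
    using has_sum_product_pair[OF assms(1,2)]
    by (subst has_sum_reindex_bij_witness[of _ "\<lambda>(n, m). (n + m, m)" "\<lambda>(N, m). (N - m, m)"
          "UNIV \<times> UNIV" "\<lambda>(n, m). a n * b m"]) auto
qed (use c in auto)

lemma summable_int_convolution:
  fixes a b :: "int \<Rightarrow> complex"
  assumes "(a has_sum P) UNIV" "(b has_sum Q) UNIV"
  shows "(\<lambda>m. a (N - m) * b m) summable_on UNIV"
proof -
  have "((\<lambda>(N, m). a (N - m) * b m) has_sum P * Q) (UNIV \<times> UNIV)"
    using has_sum_product_pair[OF assms(1,2)]
    by (subst has_sum_reindex_bij_witness[of _ "\<lambda>(n, m). (n + m, m)" "\<lambda>(N, m). (N - m, m)"
          "UNIV \<times> UNIV" "\<lambda>(n, m). a n * b m"]) auto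
  then have "(\<lambda>(N, m). a (N - m) * b m) summable_on (UNIV \<times> UNIV)"
    by (rule has_sum_imp_summable)
  from summable_on_SigmaD1[OF this, of N] show ?thesis by simp
qed

text \<open>The index-two sublattice of pairs with even sum is parametrised by $(s + d, s - d)$.\<close>

lemma has_sum_even_lattice:
  fixes g :: "int \<times> int \<Rightarrow> complex"
  assumes g: "(g has_sum S) (UNIV \<times> UNIV)" and odd: "\<And>n m. odd (n + m) \<Longrightarrow> g (n, m) = 0"
  shows "((\<lambda>(s, d). g (s + d, s - d)) has_sum S) (UNIV \<times> UNIV)"
proof -
  have "(g has_sum S) {(n, m). even (n + m)}"
    using g by (subst has_sum_cong_neutral[of "UNIV \<times> UNIV" _ g g]) (use odd in auto)
  moreover have "(s + d + (s - d)) div 2 = s" "(s + d - (s - d)) div 2 = d" for s d :: int by simp_all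
  moreover have "(n + m) div 2 + (n - m) div 2 = n" "(n + m) div 2 - (n - m) div 2 = m" if "even (n + m)" for n m :: int
    using that by presburger+
  ultimately show ?thesis
    by (subst has_sum_reindex_bij_witness[of _ "\<lambda>(n, m). ((n + m) div 2, (n - m) div 2)"
          "\<lambda>(s, d). (s + d, s - d)" "{(n, m). even (n + m)}" g])
       auto
qed

definition jtheta :: "complex \<Rightarrow> complex \<Rightarrow> complex" where
  "jtheta q w = (\<Sum>\<^sub>\<infinity>n::int. q powi n\<^sup>2 * w powi n)"

text \<open>The ratio of consecutive terms is x r (r^2)^n, which tends to 0 whatever x is; hence the
  theta series converges for every nonzero w and not only on an annulus.\<close>

lemma summable_power_square:
  fixes r x :: real
  assumes "0 \<le> r" "r < 1" "0 \<le> x"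
  shows "summable (\<lambda>n. r ^ (n\<^sup>2) * x ^ n)"
proof -
  have "(\<lambda>n. x * r * (r ^ 2) ^ n) \<longlonglongrightarrow> x * r * 0"
    by (intro tendsto_intros LIMSEQ_realpow_zero) (use assms in \<open>auto simp: power_less_one_iff\<close>)
  then have "eventually (\<lambda>n. x * r * (r ^ 2) ^ n < 1/2) sequentially"
    by (intro order_tendstoD(2)[where y = 0]) auto
  then obtain N where N: "\<And>n. n \<ge> N \<Longrightarrow> x * r * (r ^ 2) ^ n < 1/2"
    by (auto simp: eventually_sequentially)
  show ?thesis
  proof (rule summable_ratio_test[of "1/2" N])
    fix n assume "n \<ge> N"
    have "r ^ ((Suc n)\<^sup>2) * x ^ Suc n = (x * r * (r ^ 2) ^ n) * (r ^ (n\<^sup>2) * x ^ n)"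
      by (simp add: power2_eq_square power_add algebra_simps flip: power_mult)
    also have "\<dots> \<le> 1/2 * (r ^ (n\<^sup>2) * x ^ n)"
      using N[OF \<open>n \<ge> N\<close>] assms by (intro mult_right_mono) auto
    finally show "norm (r ^ ((Suc n)\<^sup>2) * x ^ Suc n) \<le> 1/2 * norm (r ^ (n\<^sup>2) * x ^ n)"
      using assms by simp
  qed simp
qed

lemma summable_on_int_split:
  fixes f :: "int \<Rightarrow> 'a::banach"
  assumes "summable (\<lambda>n. norm (f (int n)))" "summable (\<lambda>n. norm (f (- 1 - int n)))"
  shows "f summable_on UNIV"
proof -
  obtain S T where "((\<lambda>n. f (int n)) has_sum S) UNIV" "((\<lambda>n. f (- 1 - int n)) has_sum T) UNIV"
    using assms[THEN norm_summable_imp_summable_on] by (auto simp: summable_on_def)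
  then show ?thesis
    using has_sum_int_split by (auto simp: summable_on_def)
qed

lemma jtheta_has_sum:
  assumes "q \<noteq> 0" "norm q < 1" "w \<noteq> 0"
  shows "((\<lambda>n::int. q powi n\<^sup>2 * w powi n) has_sum jtheta q w) UNIV"
proof -
  have 1: "norm (q powi (int n)\<^sup>2 * w powi (int n)) = norm q ^ (n\<^sup>2) * norm w ^ n" for n
    by (simp add: norm_mult norm_power flip: of_nat_power)
  have 2: "norm (q powi (- 1 - int n)\<^sup>2 * w powi (- 1 - int n)) 
     = norm q ^ ((Suc n)\<^sup>2) * norm (1 / w) ^ Suc n" for n
  proof -
    have "(- 1 - int n)\<^sup>2 = int ((Suc n)\<^sup>2)" "- 1 - int n = - int (Suc n)"
      by (auto simp: power2_eq_square algebra_simps)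
    then show ?thesis
      by (simp only: power_int_minus power_int_of_nat norm_mult norm_inverse norm_power
            norm_divide norm_one power_one_over inverse_eq_divide)
  qed
  have "summable (\<lambda>n. norm q ^ (n\<^sup>2) * norm (1 / w) ^ n)"
    by (rule summable_power_square) (use assms in auto)
  then have "summable (\<lambda>n. norm q ^ ((Suc n)\<^sup>2) * norm (1 / w) ^ Suc n)"
    by (subst summable_Suc_iff)
  then have "(\<lambda>n::int. q powi n\<^sup>2 * w powi n) summable_on UNIV"
    by (intro summable_on_int_split; simp only: 1 2)
       (auto intro!: summable_power_square simp: assms less_imp_le)
  then show ?thesis
    by (simp add: jtheta_def)
qed

section \<open>Duplication formulas and quasi-periodicity of theta\<close>

lemma power_int_lattice:
  assumes "(q::complex) \<noteq> 0"
  shows "q powi (s + d)\<^sup>2 * q powi (s - d)\<^sup>2 = (q\<^sup>2) powi s\<^sup>2 * (q\<^sup>2) powi d\<^sup>2"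
proof -
  have "(s + d)\<^sup>2 + (s - d)\<^sup>2 = 2 * s\<^sup>2 + 2 * d\<^sup>2"
    by (simp add: power2_eq_square algebra_simps)
  then show ?thesis
    using assms by (simp add: power_int_power flip: power_int_add)
qed

text \<open>The product is added to itself with its factors exchanged: the terms then carry (-1)^n +
  (-1)^m, which vanishes for odd n + m. On the remaining sublattice n = s + d, m = s - d the
  parallelogram law n^2 + m^2 = 2 s^2 + 2 d^2 separates the variables and replaces q by its
  square.\<close>

lemma jtheta_mult_minus:
  assumes "q \<noteq> 0" "norm q < 1" "w \<noteq> 0"
  shows "jtheta q w * jtheta q (- w) = jtheta (q\<^sup>2) (- (w\<^sup>2)) * jtheta (q\<^sup>2) (- 1)"
proof -
  define g where "g = (\<lambda>(n::int, m::int). q powi n\<^sup>2 * w powi n * (q powi m\<^sup>2 * (- w) powi m) 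
         + q powi n\<^sup>2 * (- w) powi n * (q powi m\<^sup>2 * w powi m))"
  have nz: "norm (q\<^sup>2) < 1" using assms by (simp add: norm_power power_less_one_iff)
  have "(g has_sum jtheta q w * jtheta q (- w) + jtheta q (- w) * jtheta q w) (UNIV \<times> UNIV)"
    using has_sum_add[OF has_sum_product_pair has_sum_product_pair,
      OF jtheta_has_sum[of q w] jtheta_has_sum[of q "- w"] jtheta_has_sum[of q "- w"] jtheta_has_sum[of q w]] assms
    by (simp add: g_def case_prod_unfold)
  moreover have "g (n, m) = 0" if "odd (n + m)" for n m
    using that by (auto simp: g_def power_int_minus_left)
  ultimately have 1: "((\<lambda>(s, d). g (s + d, s - d)) has_sum jtheta q w * jtheta q (- w) + jtheta q (- w) * jtheta q w) (UNIV \<times> UNIV)"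
    by (rule has_sum_even_lattice)
  have eq: "g (s + d, s - d) = 2 * ((q\<^sup>2) powi s\<^sup>2 * (- (w\<^sup>2)) powi s * ((q\<^sup>2) powi d\<^sup>2 * (- 1) powi d))" for s d
  proof -
    have "q powi (s + d)\<^sup>2 * q powi (s - d)\<^sup>2 = (q\<^sup>2) powi s\<^sup>2 * (q\<^sup>2) powi d\<^sup>2"
      by (rule power_int_lattice[OF assms(1)])
    moreover have "w powi (s + d) * w powi (s - d) = (w\<^sup>2) powi s"
      using assms by (simp add: power_int_power flip: power_int_add)
    moreover have "w powi (s - d) * (w powi (s + d) * (q powi (s - d)\<^sup>2 * q powi (s + d)\<^sup>2))
        = (q powi (s + d)\<^sup>2 * q powi (s - d)\<^sup>2) * (w powi (s + d) * w powi (s - d))"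
      by (simp only: mult_ac)
    ultimately show ?thesis
      by (auto simp: g_def power_int_minus_left)
  qed
  have "((\<lambda>(s, d). g (s + d, s - d)) has_sum 2 * (jtheta (q\<^sup>2) (- (w\<^sup>2)) * jtheta (q\<^sup>2) (- 1))) (UNIV \<times> UNIV)"
    unfolding eq using has_sum_cmult_right[OF has_sum_product_pair[OF jtheta_has_sum[of "q\<^sup>2" "- (w\<^sup>2)"] jtheta_has_sum[of "q\<^sup>2" "- 1"]], of 2]
       assms nz by (simp add: case_prod_unfold)
  from has_sum_unique[OF 1 this] show ?thesis by (simp add: mult.commute)
qed

text \<open>Same change of lattice; here the weight 1 + (-1)^(n+m) selects the even sublattice, and
  the two signs cancel on it.\<close>

lemma jtheta_squares:
  assumes "q \<noteq> 0" "norm q < 1"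
  shows "(jtheta q 1)\<^sup>2 + (jtheta q (- 1))\<^sup>2 = 2 * (jtheta (q\<^sup>2) 1)\<^sup>2"
proof -
  define g where "g = (\<lambda>(n::int, m::int). q powi n\<^sup>2 * 1 powi n * (q powi m\<^sup>2 * 1 powi m) 
         + q powi n\<^sup>2 * (- 1) powi n * (q powi m\<^sup>2 * (- 1) powi m))"
  have nz: "norm (q\<^sup>2) < 1" using assms by (simp add: norm_power power_less_one_iff)
  have "(g has_sum jtheta q 1 * jtheta q 1 + jtheta q (- 1) * jtheta q (- 1)) (UNIV \<times> UNIV)"
    using has_sum_add[OF has_sum_product_pair has_sum_product_pair,
      OF jtheta_has_sum[of q 1] jtheta_has_sum[of q 1] jtheta_has_sum[of q "- 1"] jtheta_has_sum[of q "- 1"]] assms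
    by (simp add: g_def case_prod_unfold)
  moreover have "g (n, m) = 0" if "odd (n + m)" for n m
    using that by (auto simp: g_def power_int_minus_left)
  ultimately have 1: "((\<lambda>(s, d). g (s + d, s - d)) has_sum jtheta q 1 * jtheta q 1 + jtheta q (- 1) * jtheta q (- 1)) (UNIV \<times> UNIV)"
    by (rule has_sum_even_lattice)
  have eq: "g (s + d, s - d) = 2 * ((q\<^sup>2) powi s\<^sup>2 * 1 powi s * ((q\<^sup>2) powi d\<^sup>2 * 1 powi d))" for s d
  proof -
    have "q powi (s + d)\<^sup>2 * q powi (s - d)\<^sup>2 = (q\<^sup>2) powi s\<^sup>2 * (q\<^sup>2) powi d\<^sup>2"
      by (rule power_int_lattice[OF assms(1)])
    then show ?thesis
      by (auto simp: g_def power_int_minus_left)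
  qed
  have "((\<lambda>(s, d). g (s + d, s - d)) has_sum 2 * (jtheta (q\<^sup>2) 1 * jtheta (q\<^sup>2) 1)) (UNIV \<times> UNIV)"
    unfolding eq using has_sum_cmult_right[OF has_sum_product_pair[OF jtheta_has_sum[of "q\<^sup>2" 1] jtheta_has_sum[of "q\<^sup>2" 1]], of 2]
       assms nz by (simp add: case_prod_unfold)
  from has_sum_unique[OF 1 this] show ?thesis by (simp add: power2_eq_square)
qed

text \<open>Only even n = 2 j survive, and (2 j)^2 = 4 j^2 gives the nome q^4. The formula serves to
  exclude a common zero of the two theta values on the boundary lines of the strip.\<close>

lemma jtheta_plus_minus:
  assumes "q \<noteq> 0" "norm q < 1" "w \<noteq> 0"
  shows "jtheta q w + jtheta q (- w) = 2 * jtheta (q ^ 4) (w\<^sup>2)"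
proof -
  define g where "g = (\<lambda>n::int. q powi n\<^sup>2 * w powi n + q powi n\<^sup>2 * (- w) powi n)"
  have nz: "norm (q ^ 4) < 1" using assms by (simp add: norm_power power_less_one_iff)
  have "(g has_sum jtheta q w + jtheta q (- w)) UNIV"
    using has_sum_add[OF jtheta_has_sum[of q w] jtheta_has_sum[of q "- w"]] assms by (simp add: g_def)
  then obtain P Q where PQ: "((\<lambda>j. g (2 * j)) has_sum P) UNIV" "((\<lambda>j. g (2 * j + 1)) has_sum Q) UNIV"
     "jtheta q w + jtheta q (- w) = P + Q"
    by (rule has_sum_int_even_odd)
  have "g (2 * j + 1) = 0" for j by (simp add: g_def power_int_minus_left)
  then have "Q = 0" using PQ(2) has_sum_unique[OF _ has_sum_0_simp] by simp
  have "g (2 * j) = 2 * ((q ^ 4) powi j\<^sup>2 * (w\<^sup>2) powi j)" for j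
    by (simp add: g_def power_int_minus_left power_int_power power_mult_distrib)
  then have "((\<lambda>j. g (2 * j)) has_sum 2 * jtheta (q ^ 4) (w\<^sup>2)) UNIV"
    using has_sum_cmult_right[OF jtheta_has_sum[of "q ^ 4" "w\<^sup>2"], of 2] assms nz by simp
  from has_sum_unique[OF PQ(1) this] PQ(3) \<open>Q = 0\<close> show ?thesis by simp
qed

text \<open>Completing the square, n^2 + 2 n + 1 = (n + 1)^2, makes the left side an index shift of
  the right one.\<close>

lemma jtheta_quasi_period:
  assumes "q \<noteq> 0" "norm q < 1" "w \<noteq> 0"
  shows "q * w * jtheta q (q\<^sup>2 * w) = jtheta q w"
proof -
  have "((\<lambda>n. q * w * (q powi n\<^sup>2 * (q\<^sup>2 * w) powi n)) has_sum q * w * jtheta q (q\<^sup>2 * w)) UNIV"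
    by (intro has_sum_cmult_right jtheta_has_sum) (use assms in auto)
  moreover have "q * w * (q powi n\<^sup>2 * (q\<^sup>2 * w) powi n) = q powi (n + 1)\<^sup>2 * w powi (n + 1)" for n
  proof -
    have "(n + 1)\<^sup>2 = 1 + 2 * n + n\<^sup>2" by (simp add: power2_eq_square algebra_simps)
    then show ?thesis
      using assms by (simp add: power_int_mult_distrib power_int_power power_int_add)
  qed
  ultimately have "((\<lambda>n. q powi (n + 1)\<^sup>2 * w powi (n + 1)) has_sum q * w * jtheta q (q\<^sup>2 * w)) UNIV"
    by simp
  then have "((\<lambda>n. q powi n\<^sup>2 * w powi n) has_sum q * w * jtheta q (q\<^sup>2 * w)) UNIV"
    by (subst (asm) has_sum_int_shift)
  with jtheta_has_sum[OF assms] show ?thesis using has_sum_unique by blast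
qed

section \<open>The Lambert series and its product with theta\<close>

text \<open>For q = e^(i pi tau) this is 1 / cos (n pi tau). The form with q^n and q^(-n) makes the
  evenness in n visible and gives the value 1 at n = 0.\<close>

definition sech_coeff :: "complex \<Rightarrow> int \<Rightarrow> complex" where
  "sech_coeff q n = 2 / (q powi n + q powi (- n))"

definition dn_series :: "complex \<Rightarrow> complex \<Rightarrow> complex" where
  "dn_series q w = (\<Sum>\<^sub>\<infinity>n::int. sech_coeff q n * w powi n)"

lemma sech_coeff_minus [simp]: "sech_coeff q (- n) = sech_coeff q n"
  by (simp add: sech_coeff_def add.commute)

lemma one_plus_power_nz:
  assumes "norm (q::complex) < 1" shows "1 + q ^ n \<noteq> 0"
proof (cases "n = 0")
  case False
  then have "norm (q ^ n) < 1"
    using assms by (simp add: norm_power power_less_one_iff)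
  then show ?thesis
    by (metis add.commute add_eq_0_iff norm_minus_cancel norm_one less_irrefl)
qed simp

lemma sech_coeff_nat:
  assumes "q \<noteq> 0"
  shows "sech_coeff q (int n) = 2 * q ^ n / (1 + q ^ (2 * n))"
proof -
  have "q powi int n + q powi (- int n) = (1 + q ^ (2 * n)) / q ^ n"
    using assms by (simp add: power_int_minus field_simps power_add mult_2_right)
  then show ?thesis
    by (simp add: sech_coeff_def)
qed

lemma sech_coeff_denom_nz:
  assumes "(q::complex) \<noteq> 0" "norm q < 1"
  shows "q powi n + q powi (- n) \<noteq> 0"
proof -
  have *: "q powi int m + q powi (- int m) \<noteq> 0" for m
  proof -
    have "q powi int m + q powi (- int m) = (1 + q ^ (2 * m)) / q ^ m"
      using assms by (simp add: power_int_minus field_simps power_add mult_2_right)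
    then show ?thesis using assms one_plus_power_nz[of q "2 * m"] by simp
  qed
  show ?thesis
    using *[of "nat n"] *[of "nat (- n)"] by (cases "n \<ge> 0") (simp_all add: add.commute)
qed

lemma norm_sech_coeff_le:
  assumes "q \<noteq> 0" "norm q < 1"
  shows "norm (sech_coeff q (int n)) \<le> 2 / (1 - norm q) * norm q ^ n"
proof -
  have "1 - norm q \<le> norm (1 + q ^ (2 * n))"
  proof (cases "n = 0")
    case False
    have "1 - norm q \<le> 1 - norm q ^ (2 * n)"
      using power_decreasing[of 1 "2 * n" "norm q"] False assms by simp
    also have "\<dots> \<le> norm (1 + q ^ (2 * n))"
      using norm_diff_ineq[of 1 "q ^ (2 * n)"] by (simp add: norm_power)
    finally show ?thesis .
  qed (auto intro: order_trans[of _ 0])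
  then have "norm q ^ n / norm (1 + q ^ (2 * n)) \<le> norm q ^ n / (1 - norm q)"
    using assms by (intro divide_left_mono mult_pos_pos) auto
  then show ?thesis
    using assms by (simp add: sech_coeff_nat norm_divide norm_mult norm_power)
qed

text \<open>The coefficients decay like |q|^|n|, so the series lives on the annulus |q| < |w| <
  1/|q|; this is what the two conditions on \<open>q * w\<close> and \<open>q / w\<close> say, and
  for w = e^(2 pi i z) it is the strip |\<beta>| < 1/2.\<close>

lemma dn_series_has_sum:
  assumes "q \<noteq> 0" "norm q < 1" "w \<noteq> 0" "norm (q * w) < 1" "norm (q / w) < 1"
  shows "((\<lambda>n. sech_coeff q n * w powi n) has_sum dn_series q w) UNIV"
proof -
  have 1: "norm (sech_coeff q (int n) * w powi (int n)) \<le> 2 / (1 - norm q) * norm (q * w) ^ n" for n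
    using mult_right_mono[OF norm_sech_coeff_le[OF assms(1,2)], of "norm w ^ n" n]
    by (simp add: norm_mult norm_power power_mult_distrib mult_ac)
  have 2: "norm (sech_coeff q (- 1 - int n) * w powi (- 1 - int n))
     \<le> 2 / (1 - norm q) * norm (q / w) ^ Suc n" for n
  proof -
    have "- 1 - int n = - int (Suc n)" by simp
    then have "norm (sech_coeff q (- 1 - int n) * w powi (- 1 - int n))
       = norm (sech_coeff q (int (Suc n))) * (1 / norm w ^ Suc n)"
      by (simp only: sech_coeff_minus power_int_minus power_int_of_nat norm_mult norm_inverse
          norm_power inverse_eq_divide norm_divide norm_one)
    also have "\<dots> \<le> 2 / (1 - norm q) * norm q ^ Suc n * (1 / norm w ^ Suc n)"
      by (intro mult_right_mono norm_sech_coeff_le[OF assms(1,2)]) auto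
    also have "\<dots> = 2 / (1 - norm q) * norm (q / w) ^ Suc n"
      by (simp add: norm_divide power_divide)
    finally show ?thesis .
  qed
  have "summable (\<lambda>n. 2 / (1 - norm q) * norm (q * w) ^ n)"
    by (intro summable_mult summable_geometric) (use assms in simp)
  moreover have "summable (\<lambda>n. 2 / (1 - norm q) * norm (q / w) ^ Suc n)"
    by (intro summable_mult summable_ignore_initial_segment[of _ 1, simplified] summable_geometric) (use assms in simp)
  ultimately have "(\<lambda>n. sech_coeff q n * w powi n) summable_on UNIV"
    by (intro summable_on_int_split)
       (rule summable_comparison_test'[where N = 0], assumption, simp only: real_norm_def abs_norm_cancel 1 2)+
  then show ?thesis by (simp add: dn_series_def)
qed

lemma alternating_theta_zero:
  assumes "((\<lambda>m::int. q powi (m\<^sup>2 + m) * (- 1) powi m) has_sum (Z::complex)) UNIV"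
  shows "Z = 0"
proof -
  have "((\<lambda>m. q powi ((- 1 - m)\<^sup>2 + (- 1 - m)) * (- 1) powi (- 1 - m)) has_sum Z) UNIV"
    using assms by (subst has_sum_int_uminus[of "\<lambda>m::int. q powi (m\<^sup>2 + m) * (- 1) powi m" "-1"])
  moreover have "(- 1 - m)\<^sup>2 + (- 1 - m) = m\<^sup>2 + m" for m :: int
    by (simp add: power2_eq_square algebra_simps)
  moreover have "(- 1) powi (- 1 - m) = - ((- 1) powi m :: complex)" for m
    by (auto simp: power_int_minus_left)
  ultimately have "((\<lambda>m::int. - (q powi (m\<^sup>2 + m) * (- 1) powi m)) has_sum Z) UNIV"
    by simp
  then have "((\<lambda>m::int. q powi (m\<^sup>2 + m) * (- 1) powi m) has_sum - Z) UNIV"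
    by (subst (asm) has_sum_uminus) simp
  with assms have "Z = - Z" using has_sum_unique by blast
  then show ?thesis by simp
qed

text \<open>The relation $c_{N+1} = q^{2N+1} c_N$ holds because the difference of the two sides is a multiple of
  $\sum_m (-1)^m q^{m^2 + m}$, which is odd under $m \mapsto -1-m$.\<close>

lemma dn_series_theta_ex:
  assumes q: "q \<noteq> 0" "norm q < 1"
  obtains c where "\<And>w. w \<noteq> 0 \<Longrightarrow> norm (q * w) < 1 \<Longrightarrow> norm (q / w) < 1 \<Longrightarrow>
     dn_series q w * jtheta q (- w) = c * jtheta q w"
proof -
  \<comment> \<open>The factor w^N is left out, so that \<open>t\<close> and \<open>c\<close> are
    independent of w and the single number \<open>c 0\<close> serves the whole annulus.\<close>
  define t where "t N m = sech_coeff q (N - m) * (q powi m\<^sup>2 * (- 1) powi m)" for N m :: int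
  define c where "c N = infsum (t N) UNIV" for N
  have c: "(t N has_sum c N) UNIV" for N
    unfolding c_def
    using summable_int_convolution[OF dn_series_has_sum[of q 1] jtheta_has_sum[of q "- 1"], of N] q
    by (intro has_sum_infsum) (simp add: t_def[abs_def])
  have rec: "c (N + 1) = q powi (2 * N + 1) * c N" for N
  proof -
    \<comment> \<open>Moving m along with N keeps N - m, so both sums contain the same value
      \<open>sech_coeff q (N - m)\<close>.\<close>
    have "((\<lambda>m. t (N + 1) (m + 1)) has_sum c (N + 1)) UNIV"
      using c[of "N + 1"] by (subst has_sum_int_shift)
    then have "((\<lambda>m. t (N + 1) (m + 1) - q powi (2 * N + 1) * t N m) has_sum
        c (N + 1) - q powi (2 * N + 1) * c N) UNIV"
      by (rule has_sum_minus) (intro has_sum_cmult_right c)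
    moreover have "t (N + 1) (m + 1) - q powi (2 * N + 1) * t N m =
        - 2 * q powi (N + 1) * (q powi (m\<^sup>2 + m) * (- 1) powi m)" for m
    proof -
      have e1: "q powi (m + 1)\<^sup>2 = q powi m\<^sup>2 * q powi (2 * m + 1)"
        using q by (simp add: power2_eq_square algebra_simps flip: power_int_add)
      \<comment> \<open>The sum of the two odd powers contains exactly the denominator of
        \<open>sech_coeff q (N - m)\<close>; after cancellation no Lambert coefficient is left, only
        a theta-like series.\<close>
      have e2: "q powi (2 * m + 1) + q powi (2 * N + 1) =
          q powi (N + m + 1) * (q powi (N - m) + q powi (- (N - m)))"
        using q by (simp add: algebra_simps flip: power_int_add)
      have e3: "sech_coeff q (N - m) * (q powi (N - m) + q powi (- (N - m))) = 2"
        using sech_coeff_denom_nz[OF q, of "N - m"]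
        by (simp only: sech_coeff_def times_divide_eq_left nonzero_mult_div_cancel_right not_False_eq_True)
      have e4: "q powi m\<^sup>2 * q powi (N + m + 1) = q powi (N + 1) * q powi (m\<^sup>2 + m)"
        using q by (simp add: algebra_simps flip: power_int_add)
      have "t (N + 1) (m + 1) - q powi (2 * N + 1) * t N m =
         - ((- 1) powi m * sech_coeff q (N - m) * q powi m\<^sup>2 * (q powi (2 * m + 1) + q powi (2 * N + 1)))"
      proof -
        have "N + 1 - (m + 1) = N - m" "(- 1) powi (m + 1) = - ((- 1) powi m :: complex)"
          by (simp_all add: power_int_minus_left)
        moreover have "s * (a * b * - u) - c * (s * (a * u)) = - (u * s * a * (b + c))" for s a b c u :: complex
          by (simp add: algebra_simps)
        ultimately show ?thesis unfolding t_def e1 by (simp only:)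
      qed
      also have "\<dots> = - ((- 1) powi m * (sech_coeff q (N - m) * (q powi (N - m) + q powi (- (N - m))))
          * (q powi m\<^sup>2 * q powi (N + m + 1)))"
        unfolding e2 by (simp only: mult_ac)
      also have "\<dots> = - 2 * q powi (N + 1) * (q powi (m\<^sup>2 + m) * (- 1) powi m)"
        unfolding e3 e4 by simp
      finally show ?thesis .
    qed
    ultimately have *: "((\<lambda>m. - 2 * q powi (N + 1) * (q powi (m\<^sup>2 + m) * (- 1) powi m)) has_sum
        c (N + 1) - q powi (2 * N + 1) * c N) UNIV"
      by simp
    then have "((\<lambda>m. q powi (m\<^sup>2 + m) * (- 1) powi m) has_sum
        (c (N + 1) - q powi (2 * N + 1) * c N) / (- 2 * q powi (N + 1))) UNIV"
      using has_sum_divide_const[OF *, of "- 2 * q powi (N + 1)"] q by simp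
    from alternating_theta_zero[OF this] q show ?thesis by simp
  qed
  have cN: "c N = q powi N\<^sup>2 * c 0" for N
  proof (induction N rule: int_induct[where k = 0])
    case base
    show ?case by simp
  next
    case (step1 i)
    have "q powi (2 * i + 1) * q powi i\<^sup>2 = q powi (i + 1)\<^sup>2"
      using q by (simp add: power2_eq_square algebra_simps flip: power_int_add)
    then show ?case using rec[of i] step1 by (simp flip: mult.assoc)
  next
    case (step2 i)
    have "q powi (2 * (i - 1) + 1) * q powi (i - 1)\<^sup>2 = q powi i\<^sup>2"
      using q by (simp add: power2_eq_square algebra_simps flip: power_int_add)
    then have "q powi (2 * (i - 1) + 1) * c (i - 1) = q powi (2 * (i - 1) + 1) * (q powi (i - 1)\<^sup>2 * c 0)"
      using rec[of "i - 1"] step2 by (simp flip: mult.assoc)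
    then show ?case using q by simp
  qed
  show ?thesis
  proof (rule that[of "c 0"])
    fix w :: complex assume w: "w \<noteq> 0" "norm (q * w) < 1" "norm (q / w) < 1"
    have "((\<lambda>N. w powi N * c N) has_sum dn_series q w * jtheta q (- w)) UNIV"
    proof (rule has_sum_int_convolution[OF dn_series_has_sum[OF q w] jtheta_has_sum[of q "- w"]])
      fix N
      have "sech_coeff q (N - m) * w powi (N - m) * (q powi m\<^sup>2 * (- w) powi m) = w powi N * t N m" for m
        using w by (auto simp: t_def power_int_diff power_int_minus_left)
      then show "((\<lambda>m. sech_coeff q (N - m) * w powi (N - m) * (q powi m\<^sup>2 * (- w) powi m)) has_sum w powi N * c N) UNIV"
        using has_sum_cmult_right[OF c[of N], of "w powi N"] by simp
    qed (use q w in auto)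
    moreover have "((\<lambda>N. w powi N * c N) has_sum c 0 * jtheta q w) UNIV"
      using has_sum_cmult_right[OF jtheta_has_sum[OF q w(1)], of "c 0"]
      by (subst cN) (simp add: mult_ac)
    ultimately show "dn_series q w * jtheta q (- w) = c 0 * jtheta q w"
      using has_sum_unique by blast
  qed
qed

section \<open>Degeneration as the nome tends to 0, and zeros of theta\<close>

lemma has_sum_int_dist_bound:
  fixes f :: "int \<Rightarrow> complex"
  assumes "(f has_sum S) UNIV" "0 \<le> \<rho>" "\<rho> < 1"
    and "\<And>n. norm (f (int (Suc n))) \<le> C * \<rho> ^ Suc n" "\<And>n. norm (f (- int (Suc n))) \<le> C * \<rho> ^ Suc n"
  shows "norm (S - f 0) \<le> 2 * C * \<rho> / (1 - \<rho>)"
proof -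
  have s: "(\<lambda>n. 2 * C * \<rho> * \<rho> ^ n) sums (2 * C * \<rho> * (1 / (1 - \<rho>)))"
    by (intro sums_mult geometric_sums) (use assms in simp)
  have "(\<lambda>n. f (int (Suc n)) + f (- int (Suc n))) sums (S - f 0)"
    using has_sum_int_imp_nat[OF assms(1)] by (rule has_sum_imp_sums)
  then have "norm (S - f 0) = norm (\<Sum>n. f (int (Suc n)) + f (- int (Suc n)))"
    by (simp add: sums_iff)
  also have "\<dots> \<le> (\<Sum>n. 2 * C * \<rho> * \<rho> ^ n)"
  proof (rule norm_suminf_le)
    show "norm (f (int (Suc n)) + f (- int (Suc n))) \<le> 2 * C * \<rho> * \<rho> ^ n" for n
      using norm_triangle_ineq[of "f (int (Suc n))" "f (- int (Suc n))"] assms(4,5)[of n] by simp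
  qed (use s in \<open>simp add: sums_iff\<close>)
  also have "\<dots> = 2 * C * \<rho> / (1 - \<rho>)"
    using s by (simp add: sums_iff)
  finally show ?thesis .
qed

text \<open>Writing n^2 = n (n - 1) + n gives |q^(n^2) x^n| <= |q x|^n. With x = w and x = 1/w both
  halves of the series are dominated by a geometric series in \<open>\<rho>\<close>, which makes the
  bound depend on the annulus condition alone.\<close>

lemma jtheta_dist_one:
  assumes "q \<noteq> 0" "w \<noteq> 0" "norm (q * w) \<le> \<rho>" "norm (q / w) \<le> \<rho>" "\<rho> < 1" "norm q < 1"
  shows "norm (jtheta q w - 1) \<le> 2 * \<rho> / (1 - \<rho>)"
proof -
  have *: "norm (q ^ ((Suc n)\<^sup>2) * x ^ Suc n) \<le> \<rho> ^ Suc n" if "norm (q * x) \<le> \<rho>" for x n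
  proof -
    have "(Suc n)\<^sup>2 = n * Suc n + Suc n" by (simp add: power2_eq_square)
    then have "norm (q ^ ((Suc n)\<^sup>2) * x ^ Suc n) = norm q ^ (n * Suc n) * norm (q * x) ^ Suc n"
      by (simp add: norm_mult norm_power power_add power_mult_distrib mult_ac)
    also have "\<dots> \<le> 1 * \<rho> ^ Suc n"
      using that assms by (intro mult_mono power_le_one power_mono) auto
    finally show ?thesis by simp
  qed
  have "0 \<le> \<rho>" using assms(3) norm_ge_zero order_trans by blast
  have "norm (jtheta q w - q powi 0\<^sup>2 * w powi 0) \<le> 2 * 1 * \<rho> / (1 - \<rho>)"
  proof (rule has_sum_int_dist_bound[OF jtheta_has_sum])
    show "norm (q powi (int (Suc n))\<^sup>2 * w powi int (Suc n)) \<le> 1 * \<rho> ^ Suc n" for n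
      using *[OF assms(3), of n] by (simp only: power_int_of_nat mult_1 flip: of_nat_power)
    show "norm (q powi (- int (Suc n))\<^sup>2 * w powi (- int (Suc n))) \<le> 1 * \<rho> ^ Suc n" for n
      using *[of "1 / w" n] assms(4)
      by (simp only: power_int_of_nat power_int_minus power2_minus inverse_eq_divide power_one_over flip: of_nat_power) simp
  qed (use assms \<open>0 \<le> \<rho>\<close> in auto)
  then show ?thesis by simp
qed

lemma dn_series_dist_one:
  assumes "q \<noteq> 0" "norm q < 1"
  shows "norm (dn_series q 1 - 1) \<le> 4 / (1 - norm q) * norm q / (1 - norm q)"
proof -
  have "norm (dn_series q 1 - sech_coeff q 0 * 1 powi 0) \<le> 2 * (2 / (1 - norm q)) * norm q / (1 - norm q)"
    by (rule has_sum_int_dist_bound[OF dn_series_has_sum])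
       (use assms norm_sech_coeff_le[OF assms, of "Suc n" for n] in \<open>auto simp del: of_nat_Suc\<close>)
  then show ?thesis by (simp add: sech_coeff_def)
qed

lemma tendsto_power_two_power:
  assumes "0 \<le> (\<rho>::real)" "\<rho> < 1"
  shows "(\<lambda>k. \<rho> ^ (2 ^ k)) \<longlonglongrightarrow> 0"
  using LIMSEQ_subseq_LIMSEQ[OF LIMSEQ_realpow_zero[OF assms], of "\<lambda>k. 2 ^ k"]
  by (simp add: o_def strict_mono_def)

text \<open>The annulus condition is multiplicative: after k squarings of q and w the bound
  \<open>\<rho>\<close> becomes its power with exponent 2^k. The unimodular factor \<open>s\<close>
  carries the sign of the argument, which is not squared along.\<close>

lemma jtheta_iterate_tendsto:
  assumes "q \<noteq> 0" "w \<noteq> 0" "norm (q * w) < 1" "norm (q / w) < 1" "norm q < 1" "norm s = 1"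
  shows "(\<lambda>k. jtheta (q ^ (2 ^ k)) (s * w ^ (2 ^ k))) \<longlonglongrightarrow> 1"
proof -
  define \<rho> where "\<rho> = max (norm (q * w)) (norm (q / w))"
  have \<rho>: "0 \<le> \<rho>" "\<rho> < 1" using assms by (auto simp: \<rho>_def le_max_iff_disj)
  have "(\<lambda>k. 2 * \<rho> ^ (2 ^ k) / (1 - \<rho> ^ (2 ^ k))) \<longlonglongrightarrow> 2 * 0 / (1 - 0)"
    by (intro tendsto_intros tendsto_power_two_power \<rho>) auto
  then have lim: "(\<lambda>k. 2 * \<rho> ^ (2 ^ k) / (1 - \<rho> ^ (2 ^ k))) \<longlonglongrightarrow> 0" by simp
  have ev: "eventually (\<lambda>k. norm (jtheta (q ^ (2 ^ k)) (s * w ^ (2 ^ k)) - 1) \<le> 2 * \<rho> ^ (2 ^ k) / (1 - \<rho> ^ (2 ^ k))) sequentially"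
    proof (intro always_eventually allI jtheta_dist_one)
      fix k :: nat
      have "norm (q * w) ^ (2 ^ k) \<le> \<rho> ^ (2 ^ k)" "norm (q / w) ^ (2 ^ k) \<le> \<rho> ^ (2 ^ k)"
        by (intro power_mono; simp add: \<rho>_def)+
      then show "norm (q ^ (2 ^ k) * (s * w ^ (2 ^ k))) \<le> \<rho> ^ (2 ^ k)"
          "norm (q ^ (2 ^ k) / (s * w ^ (2 ^ k))) \<le> \<rho> ^ (2 ^ k)"
        using assms(6) by (simp_all add: norm_mult norm_power norm_divide power_mult_distrib power_divide)
      show "\<rho> ^ (2 ^ k) < 1" "norm (q ^ (2 ^ k)) < 1"
        using \<rho> assms by (simp_all add: power_less_one_iff norm_power)
    qed (use assms in auto)
  from Lim_null_comparison[OF ev lim] show ?thesis by (rule LIM_zero_cancel)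
qed

text \<open>Zeros propagate along $(q, w) \mapsto (q^2, w^2)$ by the product formula, but the values tend to 1.\<close>

lemma jtheta_minus_one_nz:
  assumes "q \<noteq> 0" "norm q < 1"
  shows "jtheta q (- 1) \<noteq> 0"
proof
  assume z: "jtheta q (- 1) = 0"
  have "jtheta (q ^ (2 ^ k)) (- 1) = 0" for k
  proof (induction k)
    case (Suc k)
    have "norm (q ^ 2 ^ k) < 1" using assms by (simp add: norm_power power_less_one_iff)
    then show ?case
      using jtheta_mult_minus[of "q ^ (2 ^ k)" 1] Suc assms by (simp add: power_mult[symmetric] mult.commute)
  qed (use z in simp)
  then show False
    using jtheta_iterate_tendsto[of q 1 "- 1"] assms LIMSEQ_unique[OF tendsto_const[of 0]] by fastforce
qed

text \<open>The product formula contains the second factor \<open>jtheta (q\<^sup>2) (- 1)\<close>,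
  which must be known to be nonzero before a zero can be passed on. For w = 1 the two factors on the
  right coincide, which is why that case could be settled first.\<close>

lemma jtheta_nz:
  assumes "q \<noteq> 0" "norm q < 1" "w \<noteq> 0" "norm (q * w) < 1" "norm (q / w) < 1"
  shows "jtheta q (- w) \<noteq> 0"
proof
  assume z: "jtheta q (- w) = 0"
  have "jtheta (q ^ (2 ^ k)) (- (w ^ (2 ^ k))) = 0" for k
  proof (induction k)
    case (Suc k)
    have "norm (q ^ 2 ^ k) < 1" "norm ((q ^ 2 ^ k)\<^sup>2) < 1"
      using assms by (simp_all add: norm_power power_less_one_iff)
    then show ?case
      using jtheta_mult_minus[of "q ^ (2 ^ k)" "w ^ (2 ^ k)"] Suc assms jtheta_minus_one_nz[of "(q ^ (2 ^ k))\<^sup>2"]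
      by (simp add: power_mult[symmetric] mult.commute)
  qed (use z in simp)
  then show False
    using jtheta_iterate_tendsto[of q w "- 1"] assms LIMSEQ_unique[OF tendsto_const[of 0]] by fastforce
qed

text \<open>Only even indices survive, and q^(2j) = (q^2)^j identifies their coefficients with those
  for the nome q^2.\<close>

lemma dn_series_plus_minus:
  assumes "q \<noteq> 0" "norm q < 1"
  shows "dn_series q 1 + dn_series q (- 1) = 2 * dn_series (q\<^sup>2) 1"
proof -
  define g where "g = (\<lambda>n::int. sech_coeff q n * 1 powi n + sech_coeff q n * (- 1) powi n)"
  have nz: "norm (q\<^sup>2) < 1" using assms by (simp add: norm_power power_less_one_iff)
  have "(g has_sum dn_series q 1 + dn_series q (- 1)) UNIV"
    using has_sum_add[OF dn_series_has_sum[of q 1] dn_series_has_sum[of q "- 1"]] assms by (simp add: g_def)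
  then obtain P Q where PQ: "((\<lambda>j. g (2 * j)) has_sum P) UNIV" "((\<lambda>j. g (2 * j + 1)) has_sum Q) UNIV"
     "dn_series q 1 + dn_series q (- 1) = P + Q"
    by (rule has_sum_int_even_odd)
  have "g (2 * j + 1) = 0" for j by (simp add: g_def power_int_minus_left)
  then have "Q = 0" using PQ(2) has_sum_unique[OF _ has_sum_0_simp] by simp
  have "g (2 * j) = 2 * (sech_coeff (q\<^sup>2) j * 1 powi j)" for j
    by (simp add: g_def power_int_minus_left power_int_power sech_coeff_def)
  then have "((\<lambda>j. g (2 * j)) has_sum 2 * dn_series (q\<^sup>2) 1) UNIV"
    using has_sum_cmult_right[OF dn_series_has_sum[of "q\<^sup>2" 1], of 2] assms nz by simp
  from has_sum_unique[OF PQ(1) this] PQ(3) \<open>Q = 0\<close> show ?thesis by simp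
qed

theorem dn_series_theta:
  assumes q: "q \<noteq> 0" "norm q < 1" and w: "w \<noteq> 0" "norm (q * w) < 1" "norm (q / w) < 1"
  shows "dn_series q w * jtheta q (- w) = jtheta q 1 * jtheta q (- 1) * jtheta q w"
proof -
  define r where "r x = dn_series x 1 / (jtheta x 1)\<^sup>2" for x
  have quotient: "r (x\<^sup>2) = r x \<and> (\<forall>w. w \<noteq> 0 \<longrightarrow> norm (x * w) < 1 \<longrightarrow> norm (x / w) < 1 \<longrightarrow>
      dn_series x w * jtheta x (- w) = r x * jtheta x 1 * jtheta x (- 1) * jtheta x w)"
    if x: "x \<noteq> 0" "norm x < 1" for x
  proof -
    obtain c where c: "\<And>w. w \<noteq> 0 \<Longrightarrow> norm (x * w) < 1 \<Longrightarrow> norm (x / w) < 1 \<Longrightarrow>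
       dn_series x w * jtheta x (- w) = c * jtheta x w"
      using dn_series_theta_ex[OF x] by blast
    have nz: "jtheta x 1 \<noteq> 0" "jtheta x (- 1) \<noteq> 0" "jtheta (x\<^sup>2) 1 \<noteq> 0"
      using jtheta_nz[of x 1] jtheta_nz[of x "- 1"] jtheta_nz[of "x\<^sup>2" "- 1"] x
      by (simp_all add: norm_power power_less_one_iff)
    have c1: "dn_series x 1 = c * jtheta x 1 / jtheta x (- 1)"
      "dn_series x (- 1) = c * jtheta x (- 1) / jtheta x 1"
      using c[of 1] c[of "- 1"] x nz by (simp_all add: field_simps)
    have r: "r x = c / (jtheta x 1 * jtheta x (- 1))"
      using nz by (simp add: r_def c1 power2_eq_square)
    \<comment> \<open>The same \<open>c\<close> occurs at w = 1 and at w = -1, so adding the two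
      values produces exactly the sum of squares to which the second Landen relation
      applies.\<close>
    have "2 * dn_series (x\<^sup>2) 1 = c * ((jtheta x 1)\<^sup>2 + (jtheta x (- 1))\<^sup>2) / (jtheta x 1 * jtheta x (- 1))"
      using dn_series_plus_minus[OF x] nz by (simp add: c1 field_simps power2_eq_square)
    then have "r (x\<^sup>2) = r x"
      unfolding r jtheta_squares[OF x] using nz by (simp add: r_def field_simps)
    then show ?thesis
      using c nz by (simp add: r)
  qed
  have "r (q ^ (2 ^ k)) = r q" for k
  proof (induction k)
    case (Suc k)
    have "norm (q ^ 2 ^ k) < 1" using q by (simp add: norm_power power_less_one_iff)
    then show ?case
      using quotient[of "q ^ (2 ^ k)"] Suc q by (simp add: power_mult[symmetric] mult.commute)
  qed simp
  moreover have "(\<lambda>k. r (q ^ (2 ^ k))) \<longlonglongrightarrow> 1 / 1\<^sup>2"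
    unfolding r_def
  proof (intro tendsto_intros)
    show "(\<lambda>k. jtheta (q ^ (2 ^ k)) 1) \<longlonglongrightarrow> 1"
      using jtheta_iterate_tendsto[of q 1 1] q by simp
    have "(\<lambda>k. 4 / (1 - norm q ^ (2 ^ k)) * norm q ^ (2 ^ k) / (1 - norm q ^ (2 ^ k))) \<longlonglongrightarrow> 4 / (1 - 0) * 0 / (1 - 0)"
      by (intro tendsto_intros tendsto_power_two_power) (use q in auto)
    then have lim: "(\<lambda>k. 4 / (1 - norm q ^ (2 ^ k)) * norm q ^ (2 ^ k) / (1 - norm q ^ (2 ^ k))) \<longlonglongrightarrow> 0" by simp
    have ev: "eventually (\<lambda>k. norm (dn_series (q ^ (2 ^ k)) 1 - 1) \<le> 4 / (1 - norm q ^ (2 ^ k)) * norm q ^ (2 ^ k) / (1 - norm q ^ (2 ^ k))) sequentially"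
      using dn_series_dist_one[of "q ^ (2 ^ k)" for k] q
      by (intro always_eventually allI) (simp add: norm_power power_less_one_iff)
    from Lim_null_comparison[OF ev lim] show "(\<lambda>k. dn_series (q ^ (2 ^ k)) 1) \<longlonglongrightarrow> 1"
      by (rule LIM_zero_cancel)
  qed simp
  ultimately have "r q = 1"
    using LIMSEQ_unique[OF tendsto_const[of "r q" sequentially]] by simp
  then show ?thesis
    using quotient[OF q] w by simp
qed

section \<open>Cotangent partial fractions and a double lattice sum\<close>

text \<open>Logarithmic derivative of Gamma(x) Gamma(1 - x) = pi / sin (pi x): both sides are
  differentiated and the common nonzero factor is cancelled.\<close>

lemma Digamma_reflection:
  fixes x :: complex
  assumes "x \<notin> \<int>"
  shows "Digamma (1 - x) - Digamma x = of_real pi * cot (of_real pi * x)"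
proof -
  have "1 - x \<notin> \<int>"
    using assms Ints_diff[OF Ints_1, of "1 - x"] by auto
  then have x: "x \<notin> \<int>\<^sub>\<le>\<^sub>0" "1 - x \<notin> \<int>\<^sub>\<le>\<^sub>0" "sin (of_real pi * x) \<noteq> 0"
    using assms nonpos_Ints_Int[of x] nonpos_Ints_Int[of "1 - x"]
    by (auto simp: sin_eq_0)
  let ?s = "sin (of_real pi * x)" and ?G = "Gamma x * Gamma (1 - x)"
  have "((\<lambda>x. Gamma x * Gamma (1 - x)) has_field_derivative
      ?G * (Digamma x - Digamma (1 - x))) (at x)"
    by (rule derivative_eq_intros refl x | simp add: algebra_simps)+
  moreover have "((\<lambda>x. of_real pi / sin (of_real pi * x)) has_field_derivative
      (of_real pi / ?s) * - (of_real pi * cot (of_real pi * x))) (at x)"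
    using x(3) by (auto intro!: derivative_eq_intros simp: cot_def)
  ultimately have eq: "?G * (Digamma x - Digamma (1 - x)) = (of_real pi / ?s) * - (of_real pi * cot (of_real pi * x))"
    unfolding Gamma_reflection_complex by (rule DERIV_unique)
  have nz: "of_real pi / ?s \<noteq> (0 :: complex)" using x(3) by simp
  have "Digamma x - Digamma (1 - x) = - (of_real pi * cot (of_real pi * x))"
    by (rule iffD1[OF mult_left_cancel[OF nz] eq[unfolded Gamma_reflection_complex]])
  then show ?thesis by (simp add: algebra_simps)
qed

lemma summable_norm_inverse_diff:
  fixes x y :: complex
  shows "summable (\<lambda>n. norm (inverse (x + of_nat n) - inverse (y + of_nat n)))"
proof (rule summable_comparison_test')
  \<comment> \<open>Beyond this index both |x + n| and |y + n| are at least n/2, so the difference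
    of the inverses is at most 4 |y - x| / n^2.\<close>
  define N where "N = nat \<lceil>2 * (norm x + norm y) + 1\<rceil>"
  show "summable (\<lambda>n. 4 * norm (y - x) * inverse (real n ^ 2))"
    by (intro summable_mult inverse_power_summable order_refl)
  fix n assume "n \<ge> N"
  then have n: "2 * (norm x + norm y) + 1 \<le> real n"
    unfolding N_def by linarith
  have tri: "real n - norm x \<le> norm (x + of_nat n)" "real n - norm y \<le> norm (y + of_nat n)"
    using norm_diff_ineq[of "of_nat n" x] norm_diff_ineq[of "of_nat n" y] by (simp_all add: add.commute)
  have half: "N / 2 \<le> c" if "N - a \<le> c" "2 * (a + b) + 1 \<le> N" "0 \<le> b" for N a b c :: real
    using that by argo
  have x: "real n / 2 \<le> norm (x + of_nat n)" and y: "real n / 2 \<le> norm (y + of_nat n)"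
    using half[OF tri(1) n] half[OF tri(2), of "norm x"] n by (simp_all add: add.commute)
  have pos: "real n > 0"
    by (rule less_le_trans[OF _ n]) (intro add_nonneg_pos mult_nonneg_nonneg add_nonneg_nonneg; simp)
  have nz: "x + of_nat n \<noteq> 0" "y + of_nat n \<noteq> 0" using x y pos by force+
  have "norm (inverse (x + of_nat n) - inverse (y + of_nat n)) = norm (y - x) / (norm (x + of_nat n) * norm (y + of_nat n))"
    using nz by (simp add: field_simps norm_divide norm_mult flip: norm_mult)
  also have "\<dots> \<le> norm (y - x) / (real n / 2 * (real n / 2))"
    using x y pos by (intro divide_left_mono mult_mono mult_pos_pos) auto
  also have "\<dots> = 4 * norm (y - x) * inverse (real n ^ 2)"
    using pos by (simp add: field_simps power2_eq_square)
  finally show "norm (norm (inverse (x + of_nat n) - inverse (y + of_nat n))) \<le> 4 * norm (y - x) * inverse (real n ^ 2)"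
    by simp
qed

lemma has_sum_Digamma_diff:
  fixes x y :: complex
  assumes "x \<noteq> 0" "y \<noteq> 0"
  shows "((\<lambda>n. inverse (x + of_nat n) - inverse (y + of_nat n)) has_sum Digamma y - Digamma x) UNIV"
proof (rule norm_summable_imp_has_sum[OF summable_norm_inverse_diff])
  have "(\<lambda>n. inverse (of_nat (Suc n)) - inverse (z + of_nat n)) sums (Digamma z + euler_mascheroni)"
    if "z \<noteq> 0" for z :: complex
    using summable_sums[OF summable_Digamma[OF that]] by (simp add: Digamma_def)
  from sums_diff[OF this[OF assms(2)] this[OF assms(1)]]
  show "(\<lambda>n. inverse (x + of_nat n) - inverse (y + of_nat n)) sums (Digamma y - Digamma x)"
    by (simp add: algebra_simps)
qed

text \<open>A single series of 1/(x + m) is not unconditionally summable over the integers, so the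
  partial fractions of the cotangent are stated for a difference. The half m >= 0 gives Digamma at x
  and y; on the negative half x + m = -(1 - x + n), which gives Digamma at 1 - x and 1 - y, and the
  reflection formula combines the two.\<close>

lemma has_sum_cot_diff:
  fixes x y :: complex
  assumes "x \<notin> \<int>" "y \<notin> \<int>"
  shows "((\<lambda>m::int. 1 / (x + of_int m) - 1 / (y + of_int m)) has_sum
           of_real pi * (cot (of_real pi * x) - cot (of_real pi * y))) UNIV"
proof -
  have nz: "x \<noteq> 0" "y \<noteq> 0" "1 - x \<noteq> 0" "1 - y \<noteq> 0" using assms by auto
  have "((\<lambda>m::int. 1 / (x + of_int m) - 1 / (y + of_int m)) has_sum
           (Digamma y - Digamma x) + (Digamma (1 - x) - Digamma (1 - y))) UNIV"
  proof (rule has_sum_int_split)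
    show "((\<lambda>n. 1 / (x + of_int (int n)) - 1 / (y + of_int (int n))) has_sum Digamma y - Digamma x) UNIV"
      using has_sum_Digamma_diff[OF nz(1,2)] by (simp add: inverse_eq_divide)
    have "1 / (x + of_int (- 1 - int n)) - 1 / (y + of_int (- 1 - int n)) =
       inverse (1 - y + of_nat n) - inverse (1 - x + of_nat n)" for n
    proof -
      have "1 / (u + of_int (- 1 - int n)) = - inverse (1 - u + of_nat n)" for u :: complex
        by (simp add: inverse_eq_divide flip: minus_divide_right)
           (metis (no_types, opaque_lifting) add.commute add_diff_eq diff_diff_eq2 minus_diff_eq minus_divide_right uminus_add_conv_diff)
      then show ?thesis by simp
    qed
    then show "((\<lambda>n. 1 / (x + of_int (- 1 - int n)) - 1 / (y + of_int (- 1 - int n))) has_sum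
        Digamma (1 - x) - Digamma (1 - y)) UNIV"
      using has_sum_Digamma_diff[OF nz(4,3)] by simp
  qed
  then show ?thesis
    using Digamma_reflection[OF assms(1)] Digamma_reflection[OF assms(2)]
    by (simp add: algebra_simps)
qed

text \<open>The weights 1, -3, 3, -1 have sum 0, so the combination is d0 - 2 d1 + d2 in terms of
  the consecutive differences, each of which is summable.\<close>

lemma has_sum_cot_third_diff:
  fixes x :: "nat \<Rightarrow> complex"
  assumes "\<And>i. x i \<notin> \<int>"
  shows "((\<lambda>m::int. 1 / (x 0 + of_int m) - 3 / (x 1 + of_int m) + 3 / (x 2 + of_int m) - 1 / (x 3 + of_int m)) has_sum
     of_real pi * (cot (of_real pi * x 0) - 3 * cot (of_real pi * x 1) + 3 * cot (of_real pi * x 2) - cot (of_real pi * x 3))) UNIV"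
proof -
  note d = has_sum_cot_diff[OF assms assms]
  have "((\<lambda>m::int. (1 / (x 0 + of_int m) - 1 / (x 1 + of_int m)) - 2 * (1 / (x 1 + of_int m) - 1 / (x 2 + of_int m))
        + (1 / (x 2 + of_int m) - 1 / (x 3 + of_int m))) has_sum
      of_real pi * (cot (of_real pi * x 0) - cot (of_real pi * x 1)) - 2 * (of_real pi * (cot (of_real pi * x 1) - cot (of_real pi * x 2)))
       + of_real pi * (cot (of_real pi * x 2) - cot (of_real pi * x 3))) UNIV"
    by (intro has_sum_add has_sum_minus has_sum_cmult_right d)
  then show ?thesis
    by (simp add: algebra_simps)
qed

lemma third_diff_inverse:
  fixes p t :: complex
  assumes "p \<noteq> 0" "p + t \<noteq> 0" "p + 2 * t \<noteq> 0" "p + 3 * t \<noteq> 0"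
  shows "1 / p - 3 / (p + t) + 3 / (p + 2 * t) - 1 / (p + 3 * t) = 6 * t ^ 3 / (p * (p + t) * (p + 2 * t) * (p + 3 * t))"
proof -
  have "1 / p - 3 / a + 3 / b - 1 / c = (a * b * c - 3 * p * b * c + 3 * p * a * c - p * a * b) / (p * a * b * c)"
    if "a \<noteq> 0" "b \<noteq> 0" "c \<noteq> 0" for a b c
    using that assms(1) by (simp add: diff_divide_distrib add_divide_distrib)
  moreover have "(p + t) * (p + 2 * t) * (p + 3 * t) - 3 * p * (p + 2 * t) * (p + 3 * t)
      + 3 * p * (p + t) * (p + 3 * t) - p * (p + t) * (p + 2 * t) = 6 * t ^ 3"
    by algebra
  ultimately show ?thesis using assms by simp
qed

section \<open>The double sum over the lattice of poles\<close>

lemma lattice_bound: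
  fixes \<tau> :: complex and a \<beta> :: real
  assumes \<tau>: "Im \<tau> > 0" and a: "0 < a" "a < 1" and \<beta>: "\<bar>\<beta>\<bar> < 1 / 2"
  obtains c where "c > 0"
    "\<And>m k::int. c * (1 + \<bar>real_of_int m\<bar>) \<le> norm (of_real (a + of_int m) + of_real (\<beta> + of_int k + 1 / 2) * \<tau>)"
    "\<And>m k::int. c * (1 + \<bar>real_of_int k\<bar>) \<le> norm (of_real (a + of_int m) + of_real (\<beta> + of_int k + 1 / 2) * \<tau>)"
proof -
  \<comment> \<open>\<open>\<delta>\<close> gives |a + m| >= \<delta> (1 + |m|): the value a
    suffices for m >= 0, and (1 - a)/2 suffices for m <= -1, with equality at m = -1.
    \<open>M\<close> bounds the real coordinate x of x + Y \<tau> by M times the modulus. In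
    \<open>L\<close>, the term 1 / Im \<tau> controls Y, and 2 M / \<delta> absorbs the additive
    constant 2, since every lattice point has modulus at least \<delta> / M.\<close>
  define \<delta> where "\<delta> = min a ((1 - a) / 2)"
  define M where "M = 1 + norm \<tau> / Im \<tau>"
  define L where "L = 2 * M / \<delta> + 1 / Im \<tau>"
  have \<delta>: "\<delta> > 0" "\<delta> \<le> a" "\<delta> \<le> (1 - a) / 2" using a by (auto simp: \<delta>_def min_def)
  have M: "M > 0" using \<tau> by (auto simp: M_def intro!: add_pos_nonneg)
  have L: "L > 0" using \<tau> \<delta> M by (auto simp: L_def intro!: add_pos_pos)
  have X: "\<delta> * (1 + \<bar>real_of_int m\<bar>) \<le> \<bar>a + of_int m\<bar>" for m :: int
  proof (cases "m \<ge> 0")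
    case True
    have "\<delta> * (1 + \<bar>real_of_int m\<bar>) \<le> a * (1 + real_of_int m)"
      using True a by (intro mult_mono \<delta>) auto
    also have "\<dots> \<le> a + of_int m"
      using True a by (simp add: algebra_simps mult_left_le_one_le)
    finally show ?thesis using True a by simp
  next
    case False
    then have m: "real_of_int m \<le> -1" by linarith
    have "\<delta> * (1 + \<bar>real_of_int m\<bar>) \<le> (1 - a) / 2 * (1 - of_int m)"
      using m a by (intro mult_mono \<delta>) auto
    also have "\<dots> \<le> - of_int m - a"
    proof -
      have "0 \<le> (- 1 - of_int m) * (1 + a)" using m a by (intro mult_nonneg_nonneg) auto
      then show ?thesis by (simp add: field_simps)
    qed
    finally show ?thesis using m a by simp
  qed
  have p1: "\<bar>Y\<bar> \<le> norm (of_real x + of_real Y * \<tau>) / Im \<tau>" for x Y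
    using abs_Im_le_cmod[of "of_real x + of_real Y * \<tau>"] \<tau> by (simp add: abs_mult pos_le_divide_eq)
  have p2: "\<bar>x\<bar> \<le> norm (of_real x + of_real Y * \<tau>) * M" for x Y
  proof -
    have "\<bar>x\<bar> = norm ((of_real x + of_real Y * \<tau>) - of_real Y * \<tau>)" by simp
    also have "\<dots> \<le> norm (of_real x + of_real Y * \<tau>) + norm (of_real Y * \<tau>)"
      by (rule norm_triangle_ineq4)
    also have "norm (of_real Y * \<tau>) \<le> norm (of_real x + of_real Y * \<tau>) / Im \<tau> * norm \<tau>"
      unfolding norm_mult norm_of_real by (intro mult_right_mono p1) simp
    finally show ?thesis by (simp add: M_def algebra_simps)
  qed
  define c where "c = min (\<delta> / M) (1 / L)"
  have 1: "\<delta> / M * (1 + \<bar>real_of_int m\<bar>) \<le> norm (of_real (a + of_int m) + of_real Y * \<tau>)" for m :: int and Y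
    using order_trans[OF X p2, of m Y] M by (simp add: field_simps)
  have 2: "1 / L * (1 + \<bar>real_of_int k\<bar>) \<le> norm (of_real (a + of_int m) + of_real (\<beta> + of_int k + 1 / 2) * \<tau>)"
    (is "_ \<le> norm ?p") for m k :: int
  proof -
    have k1: "1 + \<bar>real_of_int k\<bar> \<le> 2 + \<bar>\<beta> + of_int k + 1 / 2\<bar>" using \<beta> by linarith
    have k2: "\<bar>\<beta> + of_int k + 1 / 2\<bar> \<le> norm ?p / Im \<tau>" by (rule p1)
    have k3: "2 \<le> 2 * M / \<delta> * norm ?p"
    proof -
      have "\<delta> / M * 1 \<le> \<delta> / M * (1 + \<bar>real_of_int m\<bar>)" using \<delta> M by (intro mult_left_mono) auto
      then have "\<delta> / M \<le> norm ?p" using 1[of m] by (metis mult.right_neutral order_trans)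
      then show ?thesis using \<delta> M by (simp add: field_simps)
    qed
    have "1 + \<bar>real_of_int k\<bar> \<le> 2 * M / \<delta> * norm ?p + norm ?p / Im \<tau>"
      using k1 k2 k3 by linarith
    also have "\<dots> = L * norm ?p" by (simp add: L_def distrib_right)
    finally show ?thesis using L by (simp add: pos_divide_le_eq mult.commute)
  qed
  show ?thesis
  proof (rule that[of c])
    show "c > 0" using \<delta> M L by (simp add: c_def)
    show "c * (1 + \<bar>real_of_int m\<bar>) \<le> norm (of_real (a + of_int m) + of_real (\<beta> + of_int k + 1 / 2) * \<tau>)" for m k
      by (rule order_trans[OF mult_right_mono 1]) (auto simp: c_def)
    show "c * (1 + \<bar>real_of_int k\<bar>) \<le> norm (of_real (a + of_int m) + of_real (\<beta> + of_int k + 1 / 2) * \<tau>)" for m k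
      by (rule order_trans[OF mult_right_mono 2]) (auto simp: c_def)
  qed
qed

lemma summable_on_int_inverse_square:
  "(\<lambda>m::int. 1 / (1 + \<bar>real_of_int m\<bar>)\<^sup>2) summable_on UNIV"
proof (rule summable_on_int_split)
  have s: "summable (\<lambda>n. inverse (real n ^ 2))" by (rule inverse_power_summable) simp
  show "summable (\<lambda>n. norm (1 / (1 + \<bar>real_of_int (int n)\<bar>)\<^sup>2))"
    using summable_ignore_initial_segment[OF s, of 1] by (simp add: inverse_eq_divide add.commute)
  show "summable (\<lambda>n. norm (1 / (1 + \<bar>real_of_int (- 1 - int n)\<bar>)\<^sup>2))"
    using summable_ignore_initial_segment[OF s, of 2] by (simp add: inverse_eq_divide add.commute abs_if)
qed

text \<open>The blocks of four start at the even indices 2 j and overlap: every even k gets weight 1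
  + 3 = 4 and every odd k gets -3 - 1 = -4. Summing the third differences over j therefore gives 4
  times the alternating sum over k, which is the origin of the 4 in the secant terms.\<close>

lemma double_sum_sec_cot:
  fixes \<tau> z :: complex and a \<beta> :: real
  assumes \<tau>: "Im \<tau> > 0" and a: "0 < a" "a < 1" and \<beta>: "\<bar>\<beta>\<bar> < 1 / 2"
    and z: "z = of_real a + of_real \<beta> * \<tau>"
  defines "C \<equiv> \<lambda>k::int. cot (of_real pi * (z + (of_int k + 1 / 2) * \<tau>))"
  obtains S where
    "((\<lambda>m::int. 4 * of_real pi / \<tau> / cos (of_real pi * (z + of_int m) / \<tau>)) has_sum S) UNIV"
    "((\<lambda>j::int. of_real pi * (C (2 * j) - 3 * C (2 * j + 1) + 3 * C (2 * j + 2) - C (2 * j + 3))) has_sum S) UNIV"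
proof -
  define p where "p m k = z + of_int m + (of_int k + 1 / 2) * \<tau>" for m k :: int
  have p_eq: "p m k = of_real (a + of_int m) + of_real (\<beta> + of_int k + 1 / 2) * \<tau>" for m k
    by (simp add: p_def z algebra_simps)
  obtain c where c: "c > 0" "\<And>m k. c * (1 + \<bar>real_of_int m\<bar>) \<le> norm (p m k)"
     "\<And>m k. c * (1 + \<bar>real_of_int k\<bar>) \<le> norm (p m k)"
    using lattice_bound[OF \<tau> a \<beta>] unfolding p_eq by metis
  have \<tau>0: "\<tau> \<noteq> 0" using \<tau> by auto
  have nz: "p m k \<noteq> 0" for m k
  proof
    assume "p m k = 0"
    then have "c * (1 + \<bar>real_of_int m\<bar>) \<le> 0" using c(2)[of m k] by simp
    moreover have "c * (1 + \<bar>real_of_int m\<bar>) > 0" using c(1) by (intro mult_pos_pos) auto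
    ultimately show False by simp
  qed
  define T where "T m j = 1 / p m (2 * j) - 3 / p m (2 * j + 1) + 3 / p m (2 * j + 2) - 1 / p m (2 * j + 3)" for m j
  define B where "B j = 6 * norm \<tau> ^ 3 / c ^ 4 * (1 / (1 + \<bar>real_of_int j\<bar>)\<^sup>2)" for j
  define A where "A m = 1 / (1 + \<bar>real_of_int m\<bar>)\<^sup>2" for m :: int
  have bound: "norm (T m j) \<le> A m * B j" for m j
  proof -
    define u v where "u = c * (1 + \<bar>real_of_int m\<bar>)" and "v = c * (1 + \<bar>real_of_int j\<bar>)"
    have uv: "u > 0" "v > 0" using c(1) by (auto simp: u_def v_def intro!: mult_pos_pos)
    have shift: "p m (2 * j + 1) = p m (2 * j) + \<tau>" "p m (2 * j + 2) = p m (2 * j) + 2 * \<tau>"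
      "p m (2 * j + 3) = p m (2 * j) + 3 * \<tau>"
      by (simp_all add: p_def algebra_simps)
    have "T m j = 6 * \<tau> ^ 3 / (p m (2 * j) * p m (2 * j + 1) * p m (2 * j + 2) * p m (2 * j + 3))"
      using third_diff_inverse[of "p m (2 * j)" \<tau>] nz[of m "2 * j"] nz[of m "2 * j + 1"]
        nz[of m "2 * j + 2"] nz[of m "2 * j + 3"] by (simp add: T_def shift)
    then have "norm (T m j) = 6 * norm \<tau> ^ 3 / (norm (p m (2 * j)) * norm (p m (2 * j + 1)) * norm (p m (2 * j + 2)) * norm (p m (2 * j + 3)))"
      by (simp add: norm_divide norm_mult norm_power)
    \<comment> \<open>Two factors are spent on each direction. The bound by \<open>v\<close> is
      taken on the indices 2 j and 2 j + 1, whose absolute values are at least |j|; for 2 j + 2 this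
      fails at j = -1. The bound by \<open>u\<close> is available for every index.\<close>
    also have "\<dots> \<le> 6 * norm \<tau> ^ 3 / (v * v * u * u)"
    proof -
      have 1: "v \<le> norm (p m (2 * j))"
        by (rule order_trans[OF _ c(3)]) (use c(1) in \<open>auto simp: v_def intro!: mult_left_mono\<close>)
      have "\<bar>real_of_int j\<bar> \<le> \<bar>real_of_int (2 * j + 1)\<bar>"
        unfolding of_int_abs[symmetric] of_int_le_iff by linarith
      then have 2: "v \<le> norm (p m (2 * j + 1))"
        by (intro order_trans[OF _ c(3)]) (use c(1) in \<open>auto simp: v_def intro!: mult_left_mono\<close>)
      show ?thesis
        using 1 2 c(2)[of m] uv nz
        by (intro divide_left_mono mult_mono mult_pos_pos) (auto simp: u_def)
    qed
    also have "\<dots> = A m * B j"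
      using c(1) by (simp add: A_def B_def u_def v_def field_simps power2_eq_square power4_eq_xxxx)
    finally show ?thesis .
  qed
  have sA: "A summable_on UNIV" unfolding A_def by (rule summable_on_int_inverse_square)
  have sB: "B summable_on UNIV" unfolding B_def by (intro summable_on_cmult_right summable_on_int_inverse_square)
  have rowsum: "((\<lambda>j. T m j) has_sum 4 * of_real pi / \<tau> / cos (of_real pi * (z + of_int m) / \<tau>)) UNIV" for m
  proof -
    define y where "y = (z + of_int m) / \<tau> + 1 / 2"
    have pk: "p m k = \<tau> * (y + of_int k)" for k
      using \<tau>0 by (simp add: p_def y_def field_simps)
    \<comment> \<open>Since j advances k by 2, each of the four columns is a cotangent series in (y
      + i)/2 with scale 2 \<tau>. Consecutive arguments differ by 1/2, so the cotangents alternate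
      between cot and -tan, and the weights collapse to 4 (cot + tan) = 4 / (sin cos).\<close>
    define x :: "nat \<Rightarrow> complex" where "x i = (y + of_nat i) / 2" for i
    have x: "x i \<notin> \<int>" for i
    proof
      assume "x i \<in> \<int>"
      then obtain n where "x i = of_int n" by (auto elim: Ints_cases)
      then have "y + of_int (int i - 2 * n) = 0" by (simp add: x_def add_diff_eq)
      then show False using nz[of m "int i - 2 * n"] by (simp only: pk) simp
    qed
    have eq: "1 / (2 * \<tau>) * (1 / (x 0 + of_int j) - 3 / (x 1 + of_int j) + 3 / (x 2 + of_int j) - 1 / (x 3 + of_int j)) = T m j" for j
    proof -
      have "1 / (2 * \<tau>) * (s / (x i + of_int j)) = s / p m (2 * j + int i)" for i s
      proof -
        have "p m (2 * j + int i) = 2 * \<tau> * (x i + of_int j)"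
          by (simp add: pk x_def field_simps)
        then show ?thesis by simp
      qed
      from this[of 1 0] this[of 3 1] this[of 3 2] this[of 1 3] show ?thesis
        unfolding T_def by (simp add: distrib_left right_diff_distrib)
    qed
    have sin: "sin (of_real pi * x 0) \<noteq> 0" "cos (of_real pi * x 0) \<noteq> 0"
    proof -
      show "sin (of_real pi * x 0) \<noteq> 0" using x[of 0] by (auto simp: sin_eq_0)
      have "sin (of_real pi * x 1) \<noteq> 0" using x[of 1] by (auto simp: sin_eq_0)
      moreover have "of_real pi * x 1 = of_real pi * x 0 + of_real pi / 2"
        by (simp add: x_def field_simps)
      ultimately show "cos (of_real pi * x 0) \<noteq> 0" by (simp add: sin_add sin_of_real cos_of_real)
    qed
    have shift: "of_real pi * x 1 = of_real pi * x 0 + of_real pi / 2" "of_real pi * x 2 = of_real pi * x 0 + of_real pi"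
       "of_real pi * x 3 = of_real pi * x 1 + of_real pi"
      by (simp_all add: x_def field_simps)
    have cots: "cot (of_real pi * x 1) = - sin (of_real pi * x 0) / cos (of_real pi * x 0)"
       "cot (of_real pi * x 2) = cot (of_real pi * x 0)"
       "cot (of_real pi * x 3) = - sin (of_real pi * x 0) / cos (of_real pi * x 0)"
    proof -
      show c1: "cot (of_real pi * x 1) = - sin (of_real pi * x 0) / cos (of_real pi * x 0)"
        unfolding shift cot_def by (simp add: sin_add cos_add)
      have "cot (u + of_real pi) = cot u" for u :: complex
        by (simp add: cot_def sin_add cos_add)
      then show "cot (of_real pi * x 2) = cot (of_real pi * x 0)"
        "cot (of_real pi * x 3) = - sin (of_real pi * x 0) / cos (of_real pi * x 0)"
        by (simp_all only: shift(2,3) c1)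
    qed
    have dbl: "2 * sin (of_real pi * x 0) * cos (of_real pi * x 0) = cos (of_real pi * (z + of_int m) / \<tau>)"
    proof -
      have "2 * sin (of_real pi * x 0) * cos (of_real pi * x 0) = sin (2 * (of_real pi * x 0))"
        by (simp add: sin_double)
      also have "2 * (of_real pi * x 0) = of_real pi * (z + of_int m) / \<tau> + of_real pi / 2"
        by (simp add: x_def y_def field_simps)
      finally show ?thesis by (simp add: sin_add)
    qed
    have "1 / (2 * \<tau>) * (of_real pi * (cot (of_real pi * x 0) - 3 * cot (of_real pi * x 1) + 3 * cot (of_real pi * x 2) - cot (of_real pi * x 3)))
      = 4 * of_real pi / \<tau> / (2 * sin (of_real pi * x 0) * cos (of_real pi * x 0))"
    proof -
      have "(sin (of_real pi * x 0))\<^sup>2 + (cos (of_real pi * x 0))\<^sup>2 = 1" by simp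
      then have "cot (of_real pi * x 0) + sin (of_real pi * x 0) / cos (of_real pi * x 0) = 1 / (sin (of_real pi * x 0) * cos (of_real pi * x 0))"
        using sin by (simp add: cot_def field_simps power2_eq_square)
      moreover have "cot (of_real pi * x 0) - 3 * cot (of_real pi * x 1) + 3 * cot (of_real pi * x 2) - cot (of_real pi * x 3)
         = 4 * (cot (of_real pi * x 0) + sin (of_real pi * x 0) / cos (of_real pi * x 0))"
        unfolding cots by simp
      ultimately show ?thesis using \<tau>0 by simp
    qed
    then show ?thesis
      using has_sum_cmult_right[OF has_sum_cot_third_diff[of x, OF x], of "1 / (2 * \<tau>)"]
      unfolding eq dbl by simp
  qed
  have colsum: "((\<lambda>m. T m j) has_sum of_real pi * (C (2 * j) - 3 * C (2 * j + 1) + 3 * C (2 * j + 2) - C (2 * j + 3))) UNIV" for j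
  proof -
    define x :: "nat \<Rightarrow> complex" where "x i = z + (of_int (2 * j + int i) + 1 / 2) * \<tau>" for i
    have px: "p m (2 * j + int i) = x i + of_int m" for m i
      by (simp add: p_def x_def algebra_simps)
    have "x i \<notin> \<int>" for i
    proof
      assume "x i \<in> \<int>"
      then obtain n where "x i = of_int n" by (auto elim: Ints_cases)
      then show False using nz[of "- n" "2 * j + int i"] unfolding px by simp
    qed
    from has_sum_cot_third_diff[of x, OF this] show ?thesis
      using px[of _ 0] px[of _ 1] px[of _ 2] px[of _ 3] by (simp add: T_def C_def x_def add_ac)
  qed
  show ?thesis
    by (rule has_sum_double_swap[OF sA sB bound rowsum colsum]) (rule that)
qed

section \<open>Evaluation along the rows and columns\<close>

lemma has_sum_geometric:
  fixes x :: complex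
  assumes "norm x < 1"
  shows "((\<lambda>n. x ^ n) has_sum 1 / (1 - x)) UNIV"
  by (rule norm_summable_imp_has_sum)
     (use assms geometric_sums[of x] in \<open>auto simp: norm_power intro: summable_geometric\<close>)

lemma summable_on_geometric:
  fixes x :: real
  assumes "0 \<le> x" "x < 1"
  shows "(\<lambda>n. x ^ n) summable_on UNIV"
  by (rule norm_summable_imp_summable_on) (use assms in \<open>auto intro: summable_geometric\<close>)

text \<open>Both series are iterated sums of (-1)^k (Q^k X)^(n+1), geometric in either index. In the
  majorant only one power of |Q|^k is kept, so that it factors. The lemma is applied with Q = q^2
  and X = q w or q / w.\<close>

lemma lambert_swap:
  fixes X Q :: complex
  assumes "norm X < 1" "norm Q < 1"
  obtains S where "((\<lambda>k. (- 1) ^ k * (Q ^ k * X / (1 - Q ^ k * X))) has_sum S) UNIV"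
    "((\<lambda>n. X ^ Suc n / (1 + Q ^ Suc n)) has_sum S) UNIV"
proof (rule has_sum_double_swap[where f = "\<lambda>k n. (- 1) ^ k * (Q ^ k * X) ^ Suc n"])
  show "(\<lambda>k. norm Q ^ k) summable_on UNIV"
    by (rule summable_on_geometric) (use assms in auto)
  show "(\<lambda>n. norm X * norm X ^ n) summable_on UNIV"
    by (intro summable_on_cmult_right summable_on_geometric) (use assms in auto)
  have le: "norm Q ^ k \<le> 1" for k
    using assms by (intro power_le_one) auto
  show "norm ((- 1) ^ k * (Q ^ k * X) ^ Suc n) \<le> norm Q ^ k * (norm X * norm X ^ n)" for k n
  proof -
    have "norm ((- 1) ^ k * (Q ^ k * X) ^ Suc n) = (norm Q ^ k) ^ Suc n * norm X ^ Suc n"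
      by (simp add: norm_mult norm_power power_mult_distrib)
    also have "\<dots> \<le> (norm Q ^ k) ^ 1 * norm X ^ Suc n"
      by (intro mult_right_mono power_decreasing le) auto
    finally show ?thesis by simp
  qed
  show "((\<lambda>n. (- 1) ^ k * (Q ^ k * X) ^ Suc n) has_sum (- 1) ^ k * (Q ^ k * X / (1 - Q ^ k * X))) UNIV" for k
  proof -
    have "norm Q ^ k * norm X \<le> 1 * norm X" by (intro mult_right_mono le) auto
    then have "norm (Q ^ k * X) < 1" using assms by (simp add: norm_mult norm_power)
    from has_sum_cmult_right[OF has_sum_geometric[OF this], of "(- 1) ^ k * (Q ^ k * X)"]
    show ?thesis by (simp add: mult_ac)
  qed
  show "((\<lambda>k. (- 1) ^ k * (Q ^ k * X) ^ Suc n) has_sum X ^ Suc n / (1 + Q ^ Suc n)) UNIV" for n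
  proof -
    have "norm (- (Q ^ Suc n)) < 1"
      unfolding norm_minus_cancel norm_power using assms by (subst power_less_one_iff) auto
    from has_sum_cmult_right[OF has_sum_geometric[OF this], of "X ^ Suc n"]
    have "((\<lambda>k. X ^ Suc n * (- (Q ^ Suc n)) ^ k) has_sum X ^ Suc n / (1 + Q ^ Suc n)) UNIV" by simp
    moreover have "X ^ Suc n * (- (Q ^ Suc n)) ^ k = (- 1) ^ k * (Q ^ k * X) ^ Suc n" for k
      unfolding power_minus[of "Q ^ Suc n"] power_mult_distrib
      by (simp add: mult_ac flip: power_mult power_Suc)
    ultimately show ?thesis by (simp only:)
  qed
qed (rule that)

text \<open>With u = x y^m one has u / (1 + u^2) = sum of (-1)^n u^(2n+1), and 2 u / (1 + u^2) is a
  secant when u is an exponential; summing over m first leaves a geometric series in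
  y^(2n+1).\<close>

lemma sech_swap:
  fixes x y :: complex
  assumes "norm x < 1" "norm y < 1"
  obtains S where "((\<lambda>m. x * y ^ m / (1 + (x * y ^ m)\<^sup>2)) has_sum S) UNIV"
    "((\<lambda>n. (- 1) ^ n * x ^ (2 * n + 1) / (1 - y ^ (2 * n + 1))) has_sum S) UNIV"
proof (rule has_sum_double_swap[where f = "\<lambda>m n. (- 1) ^ n * (x * y ^ m) ^ (2 * n + 1)"])
  show "(\<lambda>k. norm y ^ k) summable_on UNIV" "(\<lambda>k. norm x ^ k) summable_on UNIV"
    by (rule summable_on_geometric; use assms in auto)+
  have le: "norm y ^ k \<le> 1" for k
    using assms by (intro power_le_one) auto
  show "norm ((- 1) ^ n * (x * y ^ m) ^ (2 * n + 1)) \<le> norm y ^ m * norm x ^ n" for m n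
  proof -
    have "norm ((- 1) ^ n * (x * y ^ m) ^ (2 * n + 1)) = (norm y ^ m) ^ (2 * n + 1) * norm x ^ (2 * n + 1)"
      by (simp only: norm_mult norm_power power_mult_distrib norm_minus_cancel norm_one power_one mult_1)
         (rule mult.commute)
    also have "\<dots> \<le> (norm y ^ m) ^ 1 * norm x ^ n"
      by (intro mult_mono power_decreasing le) (use assms in auto)
    finally show ?thesis by simp
  qed
  show "((\<lambda>n. (- 1) ^ n * (x * y ^ m) ^ (2 * n + 1)) has_sum x * y ^ m / (1 + (x * y ^ m)\<^sup>2)) UNIV" for m
  proof -
    have "norm x * norm y ^ m \<le> norm x * 1" by (intro mult_left_mono le) auto
    then have "norm (x * y ^ m) < 1" using assms by (simp add: norm_mult norm_power)
    then have "norm (- (x * y ^ m)\<^sup>2) < 1"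
      unfolding norm_minus_cancel norm_power by (subst power_less_one_iff) auto
    from has_sum_cmult_right[OF has_sum_geometric[OF this], of "x * y ^ m"]
    have "((\<lambda>n. x * y ^ m * (- (x * y ^ m)\<^sup>2) ^ n) has_sum x * y ^ m / (1 + (x * y ^ m)\<^sup>2)) UNIV" by simp
    moreover have "u * (- u\<^sup>2) ^ n = (- 1) ^ n * u ^ (2 * n + 1)" for u :: complex and n
      unfolding power_minus[of "u\<^sup>2"] by (simp add: power_mult)
    ultimately show ?thesis by (simp only:)
  qed
  show "((\<lambda>m. (- 1) ^ n * (x * y ^ m) ^ (2 * n + 1)) has_sum (- 1) ^ n * x ^ (2 * n + 1) / (1 - y ^ (2 * n + 1))) UNIV" for n
  proof -
    have "norm (y ^ (2 * n + 1)) < 1"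
      unfolding norm_power using assms by (subst power_less_one_iff) auto
    from has_sum_cmult_right[OF has_sum_geometric[OF this], of "(- 1) ^ n * x ^ (2 * n + 1)"]
    have "((\<lambda>m. (- 1) ^ n * x ^ (2 * n + 1) * (y ^ (2 * n + 1)) ^ m) has_sum (- 1) ^ n * x ^ (2 * n + 1) / (1 - y ^ (2 * n + 1))) UNIV" by simp
    moreover have "(y ^ (2 * n + 1)) ^ m = (y ^ m) ^ (2 * n + 1)" for m
      by (simp only: power_mult[symmetric] mult.commute)
    ultimately show ?thesis by (simp only: power_mult_distrib mult.assoc)
  qed
qed (rule that)

text \<open>This form separates the limit -i of the cotangent for u -> 0 from a remainder that is a
  Lambert term in u.\<close>

lemma cot_exp:
  fixes x :: complex
  assumes "u = exp (2 * \<i> * x)" "u \<noteq> 1"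
  shows "cot x = - \<i> * (1 + 2 * (u / (1 - u)))"
proof -
  have e: "u = exp (\<i> * x) * exp (\<i> * x)" "exp (- (\<i> * x)) = 1 / exp (\<i> * x)"
    using assms(1) by (simp_all add: exp_minus inverse_eq_divide mult.assoc flip: exp_add)
  define E where "E = exp (\<i> * x)"
  have E: "E \<noteq> 0" "E * E \<noteq> 1" using assms e by (auto simp: E_def)
  have "cot x = \<i> * ((E + 1 / E) / (E - 1 / E))"
  proof -
    have "A / 2 / (B / (2 * \<i>)) = \<i> * (A / B)" for A B :: complex
    proof -
      have "A / 2 / (B / (2 * \<i>)) = A / 2 * (2 * \<i> / B)"
        by (simp only: divide_divide_eq_right times_divide_eq_right)
      then show ?thesis by simp
    qed
    then show ?thesis unfolding cot_def cos_exp_eq sin_exp_eq e E_def[symmetric] .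
  qed
  also have "(E + 1 / E) / (E - 1 / E) = (E * E + 1) / (E * E - 1)"
    using E by (simp add: divide_simps)
  also have "\<i> * ((E * E + 1) / (E * E - 1)) = - \<i> * (1 + 2 * (E * E / (1 - E * E)))"
  proof -
    have "E * E - 1 \<noteq> 0" "1 - E * E \<noteq> 0" using E by auto
    then show ?thesis by (simp add: divide_simps) algebra
  qed
  finally show ?thesis unfolding e E_def .
qed

text \<open>Cosine is even, so either exponential may be taken; the choice is left open to allow the
  one of modulus less than 1.\<close>

lemma sec_exp:
  fixes x :: complex
  assumes "e = exp (\<i> * x) \<or> e = exp (- (\<i> * x))"
  shows "1 / cos x = 2 * (e / (1 + e\<^sup>2))"
proof -
  have "e \<noteq> 0" using assms by auto
  have "cos x = (e + 1 / e) / 2"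
    using assms unfolding cos_exp_eq by (auto simp: exp_minus inverse_eq_divide add.commute)
  also have "e + 1 / e = (1 + e\<^sup>2) / e"
    using \<open>e \<noteq> 0\<close> by (simp add: field_simps power2_eq_square)
  finally show ?thesis by simp
qed

text \<open>\<open>s\<close> lists the limits of the cotangents for k -> +-infinity. Constant blocks
  cancel; only j = -1, with indices -2, ..., 1, meets the jump and contributes i - 3i - 3i +
  i.\<close>

lemma has_sum_sign_third_diff:
  defines "s \<equiv> \<lambda>k::int. if k \<ge> 0 then - \<i> else \<i>"
  shows "((\<lambda>j. s (2 * j) - 3 * s (2 * j + 1) + 3 * s (2 * j + 2) - s (2 * j + 3)) has_sum - 4 * \<i>) UNIV"
  by (rule has_sum_finite_neutralI[of "{-1}"]) (auto simp: s_def)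

lemma dn_series_nat_sum:
  assumes "q \<noteq> 0" "norm q < 1" "w \<noteq> 0" "norm (q * w) < 1" "norm (q / w) < 1"
  shows "((\<lambda>n. 2 * q ^ Suc n * (w ^ Suc n + 1 / w ^ Suc n) / (1 + q ^ (2 * Suc n))) has_sum dn_series q w - 1) UNIV"
proof -
  have "sech_coeff q (int (Suc n)) * w powi int (Suc n) + sech_coeff q (- int (Suc n)) * w powi (- int (Suc n)) =
     2 * q ^ Suc n * (w ^ Suc n + 1 / w ^ Suc n) / (1 + q ^ (2 * Suc n))" for n
  proof -
    have "c / d * u + c / d * inverse u = c * (u + 1 / u) / d" for c d u :: complex
      by (simp add: inverse_eq_divide distrib_left add_divide_distrib)
    then show ?thesis
      unfolding sech_coeff_minus sech_coeff_nat[OF assms(1)] power_int_minus power_int_of_nat .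
  qed
  then show ?thesis
    using has_sum_int_imp_nat[OF dn_series_has_sum[OF assms]] by (simp add: sech_coeff_def)
qed

text \<open>After subtraction of their limits \<open>s\<close> the cotangents are Lambert terms,
  whose alternating sum gives the terms n \<noteq> 0 of the dn series. The jump of \<open>s\<close>
  contributes -4 i, which is the term n = 0.\<close>

lemma dn_series_cot:
  fixes \<tau> z :: complex
  defines "C \<equiv> \<lambda>k::int. cot (of_real pi * (z + (of_int k + 1 / 2) * \<tau>))"
    and "q \<equiv> exp (\<i> * of_real pi * \<tau>)" and "w \<equiv> exp (2 * \<i> * of_real pi * z)"
  assumes q: "norm q < 1" and w: "norm (q * w) < 1" "norm (q / w) < 1"
  shows "((\<lambda>j. C (2 * j) - 3 * C (2 * j + 1) + 3 * C (2 * j + 2) - C (2 * j + 3)) has_sum - 4 * \<i> * dn_series q w) UNIV"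
proof -
  have nz: "q \<noteq> 0" "w \<noteq> 0" by (auto simp: q_def w_def)
  have q2: "norm (q\<^sup>2) < 1" using q by (simp add: norm_power power_less_one_iff)
  define s where "s = (\<lambda>k::int. if k \<ge> 0 then - \<i> else \<i>)"
  define g where "g k = C k - s k" for k
  have ne1: "(q\<^sup>2) ^ n * x \<noteq> 1" if "norm x < 1" for n and x :: complex
  proof -
    have "norm ((q\<^sup>2) ^ n) * norm x \<le> 1 * norm x"
      using q by (intro mult_right_mono) (auto simp: norm_power intro!: power_le_one)
    then have "norm ((q\<^sup>2) ^ n * x) < 1" using that by (simp add: norm_mult)
    then show ?thesis by auto
  qed
  have qpow: "(q\<^sup>2) ^ n * q = exp (2 * \<i> * (of_real pi * ((of_nat n + 1 / 2) * \<tau>)))" for n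
  proof -
    have "(q\<^sup>2) ^ n * q = exp (\<i> * of_real pi * \<tau>) ^ (2 * n + 1)"
      by (simp add: q_def power_mult)
    also have "\<dots> = exp (of_nat (2 * n + 1) * (\<i> * of_real pi * \<tau>))"
      by (rule exp_of_nat_mult[symmetric])
    also have "of_nat (2 * n + 1) * (\<i> * of_real pi * \<tau>) = 2 * \<i> * (of_real pi * ((of_nat n + 1 / 2) * \<tau>))"
      by (simp add: field_simps)
    finally show ?thesis .
  qed
  have neg_affine: "- \<i> * (1 + 2 * t) - - \<i> = - 2 * \<i> * t" and pos_affine: "\<i> * (1 + 2 * t) - \<i> = 2 * \<i> * t" for t
    by (simp_all add: algebra_simps)
  have s_int: "s (int n) = - \<i>" "s (- 1 - int n) = \<i>" for n by (simp_all add: s_def)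
  have gpos: "g (int n) = - 2 * \<i> * ((q\<^sup>2) ^ n * (q * w) / (1 - (q\<^sup>2) ^ n * (q * w)))" for n
  proof -
    have "(q\<^sup>2) ^ n * (q * w) = ((q\<^sup>2) ^ n * q) * w" by simp
    also have "\<dots> = exp (2 * \<i> * (of_real pi * (z + (of_int (int n) + 1 / 2) * \<tau>)))"
      unfolding qpow w_def exp_add[symmetric] by (simp add: algebra_simps)
    finally have c: "C (int n) = - \<i> * (1 + 2 * ((q\<^sup>2) ^ n * (q * w) / (1 - (q\<^sup>2) ^ n * (q * w))))"
      unfolding C_def by (rule cot_exp) (rule ne1[OF w(1)])
    show ?thesis unfolding g_def c s_int by (rule neg_affine)
  qed
  have gneg: "g (- 1 - int n) = 2 * \<i> * ((q\<^sup>2) ^ n * (q / w) / (1 - (q\<^sup>2) ^ n * (q / w)))" for n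
  proof -
    \<comment> \<open>For negative indices the exponential of modulus less than 1 belongs to the
      argument -x, so the expansion is applied there and the oddness of cot is used.\<close>
    let ?x = "of_real pi * (z + (of_int (- 1 - int n) + 1 / 2) * \<tau>)"
    have "1 / w = exp (- (2 * \<i> * of_real pi * z))"
      by (simp add: w_def exp_minus inverse_eq_divide)
    have "(q\<^sup>2) ^ n * (q / w) = ((q\<^sup>2) ^ n * q) * (1 / w)" by simp
    also have "\<dots> = exp (2 * \<i> * (- ?x))"
      unfolding qpow \<open>1 / w = _\<close> exp_add[symmetric] by (simp add: algebra_simps)
    finally have "cot (- ?x) = - \<i> * (1 + 2 * ((q\<^sup>2) ^ n * (q / w) / (1 - (q\<^sup>2) ^ n * (q / w))))"
      by (rule cot_exp) (rule ne1[OF w(2)])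
    then have c: "C (- 1 - int n) = \<i> * (1 + 2 * ((q\<^sup>2) ^ n * (q / w) / (1 - (q\<^sup>2) ^ n * (q / w))))"
      unfolding C_def cot_minus by (simp only: minus_equation_iff[of "cot ?x"] mult_minus_left minus_minus)
    show ?thesis unfolding g_def c s_int by (rule pos_affine)
  qed
  obtain A where A: "((\<lambda>k. (- 1) ^ k * ((q\<^sup>2) ^ k * (q * w) / (1 - (q\<^sup>2) ^ k * (q * w)))) has_sum A) UNIV"
      "((\<lambda>n. (q * w) ^ Suc n / (1 + (q\<^sup>2) ^ Suc n)) has_sum A) UNIV"
    using lambert_swap[OF w(1) q2] by blast
  obtain B where B: "((\<lambda>k. (- 1) ^ k * ((q\<^sup>2) ^ k * (q / w) / (1 - (q\<^sup>2) ^ k * (q / w)))) has_sum B) UNIV"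
      "((\<lambda>n. (q / w) ^ Suc n / (1 + (q\<^sup>2) ^ Suc n)) has_sum B) UNIV"
    using lambert_swap[OF w(2) q2] by blast
  have AB: "2 * A + 2 * B = dn_series q w - 1"
  proof -
    have "((\<lambda>n. 2 * ((q * w) ^ Suc n / (1 + (q\<^sup>2) ^ Suc n)) + 2 * ((q / w) ^ Suc n / (1 + (q\<^sup>2) ^ Suc n))) has_sum 2 * A + 2 * B) UNIV"
      by (intro has_sum_add has_sum_cmult_right A B)
    moreover have "2 * ((q * w) ^ Suc n / (1 + (q\<^sup>2) ^ Suc n)) + 2 * ((q / w) ^ Suc n / (1 + (q\<^sup>2) ^ Suc n)) =
        2 * q ^ Suc n * (w ^ Suc n + 1 / w ^ Suc n) / (1 + q ^ (2 * Suc n))" for n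
      by (simp only: power_mult[symmetric] power_mult_distrib power_divide add_divide_distrib distrib_left
          times_divide_eq_right times_divide_eq_left mult.right_neutral mult.assoc divide_divide_eq_left mult.commute[of "w ^ Suc n"])
    ultimately show ?thesis
      using dn_series_nat_sum[OF nz(1) q nz(2) w] has_sum_unique by (simp only:) blast
  qed
  have "((\<lambda>k. (- 1) powi k * g k) has_sum - 2 * \<i> * A + - 2 * \<i> * B) UNIV"
  proof (rule has_sum_int_split)
    show "((\<lambda>n. (- 1) powi int n * g (int n)) has_sum - 2 * \<i> * A) UNIV"
      using has_sum_cmult_right[OF A(1), of "- 2 * \<i>"] unfolding gpos power_int_of_nat
      by (simp only: mult.left_commute)
    have "(- 1) powi (- 1 - int n) * (2 * \<i> * x) = - 2 * \<i> * ((- 1) ^ n * x)" for n and x :: complex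
      by (cases "even n") (simp_all add: power_int_minus_left)
    then show "((\<lambda>n. (- 1) powi (- 1 - int n) * g (- 1 - int n)) has_sum - 2 * \<i> * B) UNIV"
      using has_sum_cmult_right[OF B(1), of "- 2 * \<i>"] unfolding gneg by (simp only:)
  qed
  then obtain P Q where PQ: "((\<lambda>j. (- 1) powi (2 * j) * g (2 * j)) has_sum P) UNIV"
     "((\<lambda>j. (- 1) powi (2 * j + 1) * g (2 * j + 1)) has_sum Q) UNIV" "- 2 * \<i> * A + - 2 * \<i> * B = P + Q"
    by (rule has_sum_int_even_odd)
  have P0: "((\<lambda>j. g (2 * j)) has_sum P) UNIV" and "((\<lambda>j. - g (2 * j + 1)) has_sum Q) UNIV"
    using PQ(1,2) by (simp_all add: power_int_minus_left)
  then have Q0: "((\<lambda>j. g (2 * j + 1)) has_sum - Q) UNIV" by (simp add: has_sum_uminus)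
  have P1: "((\<lambda>j. g (2 * j + 2)) has_sum P) UNIV"
    using P0 has_sum_int_shift[of "\<lambda>j. g (2 * j)" 1 P] by (simp add: algebra_simps)
  have Q1: "((\<lambda>j. g (2 * j + 3)) has_sum - Q) UNIV"
    using Q0 has_sum_int_shift[of "\<lambda>j. g (2 * j + 1)" 1 "- Q"] by (simp add: algebra_simps)
  have "((\<lambda>j. (g (2 * j) - 3 * g (2 * j + 1) + 3 * g (2 * j + 2) - g (2 * j + 3)) +
      (s (2 * j) - 3 * s (2 * j + 1) + 3 * s (2 * j + 2) - s (2 * j + 3))) has_sum (P - 3 * (- Q) + 3 * P - (- Q)) + - 4 * \<i>) UNIV"
    unfolding s_def by (intro has_sum_add[OF _ has_sum_sign_third_diff] has_sum_minus has_sum_add has_sum_cmult_right P0 Q0 P1 Q1)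
  moreover have "(g (2 * j) - 3 * g (2 * j + 1) + 3 * g (2 * j + 2) - g (2 * j + 3)) +
      (s (2 * j) - 3 * s (2 * j + 1) + 3 * s (2 * j + 2) - s (2 * j + 3)) =
      C (2 * j) - 3 * C (2 * j + 1) + 3 * C (2 * j + 2) - C (2 * j + 3)" for j
    by (simp add: g_def algebra_simps)
  moreover have "(P - 3 * (- Q) + 3 * P - (- Q)) + - 4 * \<i> = - 4 * \<i> * dn_series q w"
  proof -
    have "(P - 3 * (- Q) + 3 * P - (- Q)) + - 4 * \<i> = 4 * (P + Q) - 4 * \<i>" by simp
    also have "\<dots> = - 4 * \<i> * ((2 * A + 2 * B) + 1)" unfolding PQ(3)[symmetric] by (simp add: algebra_simps)
    finally show ?thesis unfolding AB by simp
  qed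
  ultimately show ?thesis by simp
qed

section \<open>The terms of the expansion in 1/\<tau>: exponential form and majorant\<close>

definition dn_sec_term :: "complex \<Rightarrow> complex \<Rightarrow> nat \<Rightarrow> complex" where
  "dn_sec_term \<tau> z n = (-1) ^ n * cos ((of_nat n + 1 / 2) * of_real pi * (2 * z - 1) / \<tau>)
                           / sin ((of_nat n + 1 / 2) * of_real pi / \<tau>)"

lemma Im_one_over_neg:
  assumes "Im \<tau> > 0"
  shows "Im (1 / \<tau>) < 0"
  using assms by (simp add: Im_divide divide_neg_pos sum_power2_gt_zero_iff)

text \<open>Since z / \<tau> = a / \<tau> + \<beta> with \<beta> real, the modulus depends on a
  only. This is why the second expansion needs a condition on \<alpha> and none on \<beta>.\<close>

lemma norm_exp_over:
  fixes a \<beta> :: real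
  assumes "\<tau> \<noteq> 0" "z = of_real a + of_real \<beta> * \<tau>"
  shows "norm (exp (- (\<i> * of_real pi * z / \<tau>))) = exp (pi * a * Im (1 / \<tau>))"
proof -
  define t where "t = 1 / \<tau>"
  have "z / \<tau> = of_real a * t + of_real \<beta>"
    using assms by (simp add: t_def field_simps)
  then have "Im (z / \<tau>) = a * Im (1 / \<tau>)" by (simp flip: t_def)
  moreover have "- (\<i> * of_real pi * z / \<tau>) = - (\<i> * of_real pi * (z / \<tau>))" by simp
  moreover have "Re (- (\<i> * of_real pi * u)) = pi * Im u" for u by simp
  ultimately show ?thesis by (simp only: norm_exp_eq_Re mult.assoc)
qed

text \<open>With r = exp (-i B) one has y^(2n+1) = r^2, while the powers of x and x' are exp (-i A)
  r and exp (i A) r. Adding the two contributions gives the cosine, and 1 - r^2 gives the sine. Here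
  x will come from the indices m >= 0 and x' from m < 0.\<close>

lemma dn_sec_term_exp:
  fixes \<tau> z :: complex
  assumes \<tau>: "\<tau> \<noteq> 0"
  defines "x \<equiv> exp (- (\<i> * of_real pi * z / \<tau>))" and "x' \<equiv> exp (- (\<i> * of_real pi * (1 - z) / \<tau>))"
    and "y \<equiv> exp (- (\<i> * of_real pi * 1 / \<tau>))"
  shows "(-1) ^ n * x ^ (2 * n + 1) / (1 - y ^ (2 * n + 1)) + (-1) ^ n * x' ^ (2 * n + 1) / (1 - y ^ (2 * n + 1))
    = - \<i> * dn_sec_term \<tau> z n"
proof -
  define A where "A = (of_nat n + 1 / 2) * of_real pi * (2 * z - 1) / \<tau>"
  define B where "B = (of_nat n + 1 / 2) * of_real pi / \<tau>"
  define r where "r = exp (- (\<i> * B))"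
  have e: "exp u ^ (2 * n + 1) = exp (of_nat (2 * n + 1) * u)" for u :: complex
    by (rule exp_of_nat_mult[symmetric])
  have x: "x ^ (2 * n + 1) = exp (- (\<i> * A)) * r"
    unfolding x_def e r_def exp_add[symmetric] A_def B_def using \<tau> by (intro arg_cong[where f = exp]) (simp add: field_simps)
  have x': "x' ^ (2 * n + 1) = exp (\<i> * A) * r"
    unfolding x'_def e r_def exp_add[symmetric] A_def B_def using \<tau> by (intro arg_cong[where f = exp]) (simp add: field_simps)
  have y: "y ^ (2 * n + 1) = r * r"
    unfolding y_def e r_def exp_add[symmetric] B_def using \<tau> by (intro arg_cong[where f = exp]) (simp add: field_simps)
  have r: "r \<noteq> 0" "exp (\<i> * B) = 1 / r" by (simp_all add: r_def exp_minus inverse_eq_divide)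
  have c: "exp (- (\<i> * A)) + exp (\<i> * A) = 2 * cos A"
    by (simp add: cos_exp_eq)
  have s: "1 - r * r = r * (2 * \<i> * sin B)"
  proof -
    have "2 * \<i> * sin B = 1 / r - r"
      unfolding sin_exp_eq r r_def[symmetric] by simp
    then show ?thesis using r(1) by (simp add: right_diff_distrib)
  qed
  have "(-1) ^ n * x ^ (2 * n + 1) / (1 - y ^ (2 * n + 1)) + (-1) ^ n * x' ^ (2 * n + 1) / (1 - y ^ (2 * n + 1))
    = (-1) ^ n * ((exp (- (\<i> * A)) + exp (\<i> * A)) * r) / (1 - r * r)"
    unfolding x x' y by (simp only: distrib_left distrib_right add_divide_distrib)
  also have "\<dots> = (-1) ^ n * (2 * cos A * r) / (r * (2 * \<i> * sin B))"
    unfolding c s ..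
  also have "\<dots> = - \<i> * ((-1) ^ n * cos A / sin B)"
  proof -
    have "- \<i> = 1 / \<i>" by simp
    then have "- \<i> * ((-1) ^ n * cos A / sin B) = ((-1) ^ n * cos A) / (\<i> * sin B)"
      by (simp only: times_divide_times_eq mult_1)
    also have "\<dots> = (2 * r * ((-1) ^ n * cos A)) / (2 * r * (\<i> * sin B))"
      using r(1) by (subst mult_divide_mult_cancel_left) auto
    finally show ?thesis by (simp only: mult_ac)
  qed
  finally show ?thesis by (simp only: dn_sec_term_def A_def B_def)
qed

text \<open>The bound does not involve \<beta>, so it is a uniform majorant along the whole line of
  fixed a; the continuity in \<beta> used later rests on this.\<close>

lemma norm_dn_sec_term_le:
  fixes a \<beta> :: real
  assumes \<tau>: "Im \<tau> > 0" and a: "0 < a" "a < 1" and z: "z = of_real a + of_real \<beta> * \<tau>"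
  defines "\<mu> \<equiv> exp (pi * a * Im (1 / \<tau>))" and "\<nu> \<equiv> exp (pi * (1 - a) * Im (1 / \<tau>))"
    and "\<rho> \<equiv> exp (pi * Im (1 / \<tau>))"
  shows "norm (dn_sec_term \<tau> z n) \<le> (\<mu> ^ n + \<nu> ^ n) / (1 - \<rho>)"
proof -
  have \<tau>0: "\<tau> \<noteq> 0" using \<tau> by auto
  have neg: "Im (1 / \<tau>) < 0" by (rule Im_one_over_neg[OF \<tau>])
  let ?x = "exp (- (\<i> * of_real pi * z / \<tau>))" and ?x' = "exp (- (\<i> * of_real pi * (1 - z) / \<tau>))"
    and ?y = "exp (- (\<i> * of_real pi * 1 / \<tau>))"
  have x: "norm ?x = \<mu>" unfolding \<mu>_def by (rule norm_exp_over[OF \<tau>0 z])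
  have x': "norm ?x' = \<nu>" unfolding \<nu>_def
    by (rule norm_exp_over[OF \<tau>0, of _ _ "- \<beta>"]) (simp add: z)
  have y: "norm ?y = \<rho>" using norm_exp_over[OF \<tau>0, of 1 1 0] by (simp add: \<rho>_def)
  have lt: "0 < \<mu>" "0 < \<nu>" "0 < \<rho>" "\<mu> \<le> 1" "\<nu> \<le> 1" "\<rho> < 1"
    using neg a by (auto simp: \<mu>_def \<nu>_def \<rho>_def mult_nonneg_nonpos mult_pos_neg)
  have den: "1 - \<rho> \<le> norm (1 - ?y ^ (2 * n + 1))"
  proof -
    have "1 - \<rho> ^ 1 \<le> 1 - \<rho> ^ (2 * n + 1)"
      using lt by (intro diff_left_mono power_decreasing) auto
    also have "\<dots> \<le> norm (1 - ?y ^ (2 * n + 1))"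
      using norm_triangle_ineq2[of 1 "?y ^ (2 * n + 1)"] by (simp only: norm_power y norm_one)
    finally show ?thesis by simp
  qed
  have "norm (dn_sec_term \<tau> z n) = norm (- \<i> * dn_sec_term \<tau> z n)" by (simp add: norm_mult)
  also have "\<dots> \<le> \<mu> ^ (2 * n + 1) / norm (1 - ?y ^ (2 * n + 1)) + \<nu> ^ (2 * n + 1) / norm (1 - ?y ^ (2 * n + 1))"
    unfolding dn_sec_term_exp[OF \<tau>0, symmetric]
    by (rule order_trans[OF norm_triangle_ineq])
       (simp only: norm_mult norm_divide norm_power x x' norm_minus_cancel norm_one power_one mult_1 order_refl)
  also have "\<dots> \<le> \<mu> ^ n / (1 - \<rho>) + \<nu> ^ n / (1 - \<rho>)"
    using lt by (intro add_mono frac_le den power_decreasing) auto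
  finally show ?thesis by (simp add: add_divide_distrib)
qed

lemma dn_sec_majorant_summable:
  fixes a :: real
  assumes \<tau>: "Im \<tau> > 0" and a: "0 < a" "a < 1"
  shows "summable (\<lambda>n. (exp (pi * a * Im (1 / \<tau>)) ^ n + exp (pi * (1 - a) * Im (1 / \<tau>)) ^ n) / (1 - exp (pi * Im (1 / \<tau>))))"
  using Im_one_over_neg[OF \<tau>] a
  by (intro summable_divide summable_add summable_geometric) (auto simp: mult_pos_neg)

lemma dn_sec_summable:
  fixes a \<beta> :: real
  assumes \<tau>: "Im \<tau> > 0" and a: "0 < a" "a < 1" and z: "z = of_real a + of_real \<beta> * \<tau>"
  shows "summable (dn_sec_term \<tau> z)"
  by (rule summable_comparison_test'[OF dn_sec_majorant_summable[OF \<tau> a]]) (rule norm_dn_sec_term_le[OF assms])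

lemma dn_series_eq_sec_sum:
  fixes a \<beta> :: real
  assumes \<tau>: "Im \<tau> > 0" and a: "0 < a" "a < 1" and \<beta>: "\<bar>\<beta>\<bar> < 1 / 2"
    and z: "z = of_real a + of_real \<beta> * \<tau>"
    and q: "norm (exp (\<i> * of_real pi * \<tau>)) < 1"
      "norm (exp (\<i> * of_real pi * \<tau>) * exp (2 * \<i> * of_real pi * z)) < 1"
      "norm (exp (\<i> * of_real pi * \<tau>) / exp (2 * \<i> * of_real pi * z)) < 1"
  shows "dn_series (exp (\<i> * of_real pi * \<tau>)) (exp (2 * \<i> * of_real pi * z)) = 2 / \<tau> * (\<Sum>n. dn_sec_term \<tau> z n)"
proof -
  have \<tau>0: "\<tau> \<noteq> 0" using \<tau> by auto
  have neg: "Im (1 / \<tau>) < 0" by (rule Im_one_over_neg[OF \<tau>])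
  define x where "x = exp (- (\<i> * of_real pi * z / \<tau>))"
  define x' where "x' = exp (- (\<i> * of_real pi * (1 - z) / \<tau>))"
  define y where "y = exp (- (\<i> * of_real pi * 1 / \<tau>))"
  have x: "norm x < 1" unfolding x_def norm_exp_over[OF \<tau>0 z] using neg a by (simp add: mult_pos_neg)
  have x': "norm x' < 1"
    unfolding x'_def by (subst norm_exp_over[OF \<tau>0, of _ "1 - a" "- \<beta>"]) (use neg a z in \<open>simp_all add: mult_pos_neg\<close>)
  have y: "norm y < 1"
    unfolding y_def by (subst norm_exp_over[OF \<tau>0, of _ 1 0]) (use neg in \<open>simp_all add: mult_pos_neg\<close>)
  obtain U where U: "((\<lambda>m. x * y ^ m / (1 + (x * y ^ m)\<^sup>2)) has_sum U) UNIV"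
    "((\<lambda>n. (- 1) ^ n * x ^ (2 * n + 1) / (1 - y ^ (2 * n + 1))) has_sum U) UNIV"
    using sech_swap[OF x y] by blast
  obtain V where V: "((\<lambda>m. x' * y ^ m / (1 + (x' * y ^ m)\<^sup>2)) has_sum V) UNIV"
    "((\<lambda>n. (- 1) ^ n * x' ^ (2 * n + 1) / (1 - y ^ (2 * n + 1))) has_sum V) UNIV"
    using sech_swap[OF x' y] by blast
  have "((\<lambda>n. - \<i> * dn_sec_term \<tau> z n) has_sum U + V) UNIV"
    using has_sum_add[OF U(2) V(2)] unfolding x_def x'_def y_def dn_sec_term_exp[OF \<tau>0] .
  then have "((\<lambda>n. \<i> * (- \<i> * dn_sec_term \<tau> z n)) has_sum \<i> * (U + V)) UNIV"
    by (rule has_sum_cmult_right)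
  then have "((\<lambda>n. dn_sec_term \<tau> z n) has_sum \<i> * (U + V)) UNIV" by simp
  then have UV: "(\<Sum>n. dn_sec_term \<tau> z n) = \<i> * (U + V)"
    using has_sum_imp_sums sums_unique by metis
  define K where "K = 4 * of_real pi / \<tau>"
  have ypow: "y ^ m = exp (- (\<i> * of_real pi * of_nat m / \<tau>))" for m
    unfolding y_def exp_of_nat_mult[symmetric] by (intro arg_cong[where f = exp]) simp
  have Kcos: "K / cos u = K * (1 / cos u)" for u by simp
  have pos: "K / cos (of_real pi * (z + of_int (int m)) / \<tau>) = 2 * K * (x * y ^ m / (1 + (x * y ^ m)\<^sup>2))" for m
  proof -
    have e: "x * y ^ m = exp (- (\<i> * (of_real pi * (z + of_int (int m)) / \<tau>)))"
      unfolding ypow x_def exp_add[symmetric] using \<tau>0 by (intro arg_cong[where f = exp]) (simp add: field_simps)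
    show ?thesis
      unfolding Kcos sec_exp[OF disjI2[OF e]] by (simp only: mult.assoc mult.left_commute)
  qed
  \<comment> \<open>For negative indices the small exponential has the opposite sign in its
    exponent; the offset -1 - m is what produces 1 - z in \<open>x'\<close>.\<close>
  have negm: "K / cos (of_real pi * (z + of_int (- 1 - int m)) / \<tau>) = 2 * K * (x' * y ^ m / (1 + (x' * y ^ m)\<^sup>2))" for m
  proof -
    have e: "x' * y ^ m = exp (\<i> * (of_real pi * (z + of_int (- 1 - int m)) / \<tau>))"
      unfolding ypow x'_def exp_add[symmetric] using \<tau>0 by (intro arg_cong[where f = exp]) (simp add: field_simps)
    show ?thesis
      unfolding Kcos sec_exp[OF disjI1[OF e]] by (simp only: mult.assoc mult.left_commute)
  qed
  have sec: "((\<lambda>m::int. K / cos (of_real pi * (z + of_int m) / \<tau>)) has_sum 2 * K * U + 2 * K * V) UNIV"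
    by (rule has_sum_int_split; unfold pos negm) (intro has_sum_cmult_right U V)+
  obtain S where S:
    "((\<lambda>m::int. K / cos (of_real pi * (z + of_int m) / \<tau>)) has_sum S) UNIV"
    "((\<lambda>j::int. of_real pi * (cot (of_real pi * (z + (of_int (2 * j) + 1 / 2) * \<tau>))
      - 3 * cot (of_real pi * (z + (of_int (2 * j + 1) + 1 / 2) * \<tau>))
      + 3 * cot (of_real pi * (z + (of_int (2 * j + 2) + 1 / 2) * \<tau>))
      - cot (of_real pi * (z + (of_int (2 * j + 3) + 1 / 2) * \<tau>)))) has_sum S) UNIV"
    using double_sum_sec_cot[OF \<tau> a \<beta> z] unfolding K_def by blast
  have "S = of_real pi * (- 4 * \<i> * dn_series (exp (\<i> * of_real pi * \<tau>)) (exp (2 * \<i> * of_real pi * z)))"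
    using has_sum_unique[OF S(2) has_sum_cmult_right[OF dn_series_cot[OF q]]] .
  moreover have "S = 2 * K * U + 2 * K * V"
    using has_sum_unique[OF S(1) sec] .
  \<comment> \<open>Both evaluations of S are written with the common factor -4 i pi, using 2 K = 8
    pi / \<tau> = (-4 i pi) (2 / \<tau>) i.\<close>
  ultimately have "of_real pi * (- 4 * \<i> * dn_series (exp (\<i> * of_real pi * \<tau>)) (exp (2 * \<i> * of_real pi * z))) =
     of_real pi * (- 4 * \<i> * (2 / \<tau> * (\<i> * (U + V))))"
    using \<tau>0 by (simp add: K_def field_simps)
  moreover have "of_real pi \<noteq> (0 :: complex)" "- 4 * \<i> \<noteq> 0" by simp_all
  ultimately show ?thesis unfolding UV by (simp only: mult_left_cancel not_False_eq_True)
qed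

section \<open>Continuity of the series\<close>

lemma continuous_on_infsum:
  fixes f :: "'a \<Rightarrow> 'b::topological_space \<Rightarrow> complex"
  assumes "\<And>n. continuous_on Y (f n)" "\<And>n y. y \<in> Y \<Longrightarrow> norm (f n y) \<le> M n" "M summable_on UNIV"
  shows "continuous_on Y (\<lambda>y. infsum (\<lambda>n. f n y) UNIV)"
proof (rule uniform_limit_theorem)
  show "uniform_limit Y (\<lambda>X y. \<Sum>n\<in>X. f n y) (\<lambda>y. infsum (\<lambda>n. f n y) UNIV) (finite_subsets_at_top UNIV)"
    by (rule Weierstrass_m_test_general) (use assms in auto)
  show "\<forall>\<^sub>F X in finite_subsets_at_top UNIV. continuous_on Y (\<lambda>y. \<Sum>n\<in>X. f n y)"
    by (intro always_eventually allI continuous_on_sum assms)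
qed simp

text \<open>On the closed annulus |w|^n <= R^n + R^(-n) for every integer n, so the theta series at
  R and at 1/R together provide the majorant.\<close>

lemma continuous_on_jtheta:
  fixes R :: real
  assumes q: "q \<noteq> 0" "norm q < 1" and R: "R > 0"
  shows "continuous_on {w. 1 / R \<le> norm w \<and> norm w \<le> R} (jtheta q)"
proof -
  define M where "M n = norm (q powi n\<^sup>2 * of_real R powi n) + norm (q powi n\<^sup>2 * of_real (1 / R) powi n)" for n :: int
  have "(\<lambda>n. q powi n\<^sup>2 * of_real R powi n) summable_on UNIV" "(\<lambda>n. q powi n\<^sup>2 * of_real (1 / R) powi n) summable_on UNIV"
    using jtheta_has_sum[OF q, of "of_real R"] jtheta_has_sum[OF q, of "of_real (1 / R)"] R
    by (auto intro: has_sum_imp_summable)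
  then have M: "M summable_on UNIV"
    unfolding M_def summable_on_iff_abs_summable_on_complex by (rule summable_on_add)
  have bound: "norm (q powi n\<^sup>2 * w powi n) \<le> M n" if w: "1 / R \<le> norm w" "norm w \<le> R" for n w
  proof -
    have w0: "norm w > 0" using w R by (meson divide_pos_pos less_le_trans zero_less_one)
    have "norm w powi n \<le> R powi n + (1 / R) powi n"
    proof (cases "n \<ge> 0")
      case True
      have "norm w powi n \<le> R powi n" by (rule power_int_mono) (use w True in auto)
      moreover have "0 \<le> (1 / R) powi n" using R by simp
      ultimately show ?thesis by simp
    next
      case False
      have "(1 / norm w) powi (- n) \<le> R powi (- n)"
      proof (rule power_int_mono)
        show "1 / norm w \<le> R" using w w0 R by (simp add: field_simps)
      qed (use False w0 in auto)
      then have "norm w powi n \<le> (1 / R) powi n"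
        using w0 R by (simp add: power_int_minus power_int_divide_distrib inverse_eq_divide)
      moreover have "0 \<le> R powi n" using R by simp
      ultimately show ?thesis by simp
    qed
    then have "norm (q powi n\<^sup>2) * norm w powi n \<le> norm (q powi n\<^sup>2) * (R powi n + (1 / R) powi n)"
      by (intro mult_left_mono) auto
    then show ?thesis
      using R by (simp add: M_def norm_mult norm_power_int distrib_left del: of_real_divide)
  qed
  show ?thesis unfolding jtheta_def
    by (rule continuous_on_infsum[OF _ bound M])
       (use R in \<open>auto intro!: continuous_intros\<close>)
qed

section \<open>The expansions of dn\<close>

text \<open>DN with its constant \<theta>3 \<theta>4 in the variables q and w. Unlike
  \<open>dn_series\<close> it is meaningful outside the annulus, so it can be followed under z -> z
  + \<tau>.\<close>

definition dn_theta :: "complex \<Rightarrow> complex \<Rightarrow> complex" where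
  "dn_theta q w = jtheta q 1 * jtheta q (- 1) * jtheta q w / jtheta q (- w)"

section \<open>Passage between the functions of z and \<tau> and those of q and w\<close>

lemma nome_nz: "nome \<tau> \<noteq> 0"
  by (simp add: nome_def)

lemma norm_nome: "norm (nome \<tau>) = exp (- (pi * Im \<tau>))"
  by (simp add: nome_def norm_exp_eq_Re)

lemma norm_nome_less_1:
  assumes "Im \<tau> > 0"
  shows "norm (nome \<tau>) < 1"
  using assms by (simp add: norm_nome)

lemma norm_exp_2pii:
  fixes a \<beta> :: real
  assumes "z = of_real a + of_real \<beta> * \<tau>"
  shows "norm (exp (2 * \<i> * of_real pi * z)) = exp (- (pi * Im \<tau> * (2 * \<beta>)))"
proof -
  have "Re (2 * \<i> * of_real pi * z) = - (pi * Im \<tau> * (2 * \<beta>))"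
    by (simp add: assms)
  then show ?thesis by (simp only: norm_exp_eq_Re)
qed

lemma norm_nome_exp_less_1:
  fixes a \<beta> :: real
  assumes \<tau>: "Im \<tau> > 0" and z: "z = of_real a + of_real \<beta> * \<tau>" and \<beta>: "\<bar>\<beta>\<bar> < 1 / 2"
  shows "norm (nome \<tau> * exp (2 * \<i> * of_real pi * z)) < 1"
    "norm (nome \<tau> / exp (2 * \<i> * of_real pi * z)) < 1"
proof -
  have *: "exp (- (pi * Im \<tau>)) * exp (- (pi * Im \<tau> * c)) < 1" if "- 1 < c" for c
  proof -
    have "0 < pi * Im \<tau> * (1 + c)" using \<tau> that by (intro mult_pos_pos) auto
    then show ?thesis by (simp add: algebra_simps flip: exp_add)
  qed
  show "norm (nome \<tau> * exp (2 * \<i> * of_real pi * z)) < 1"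
    unfolding norm_mult norm_nome norm_exp_2pii[OF z] by (rule *) (use \<beta> in linarith)
  have "exp (- (pi * Im \<tau>)) * exp (- (pi * Im \<tau> * (- (2 * \<beta>)))) < 1" by (rule *) (use \<beta> in linarith)
  then show "norm (nome \<tau> / exp (2 * \<i> * of_real pi * z)) < 1"
    unfolding norm_divide norm_nome norm_exp_2pii[OF z] by (simp add: exp_minus field_simps)
qed

text \<open>The two values of s give theta3 and theta4 at once. Pairing n with -n yields a cosine
  because s is its own inverse.\<close>

lemma theta_nat_sum:
  fixes s v :: complex
  assumes q: "q \<noteq> 0" "norm q < 1" and s: "s = 1 \<or> s = - 1"
  shows "jtheta q (s * exp (2 * \<i> * v)) = 1 + 2 * (\<Sum>n. s ^ Suc n * q ^ ((Suc n)\<^sup>2) * cos (2 * of_nat (Suc n) * v))"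
proof -
  define w where "w = s * exp (2 * \<i> * v)"
  have "w \<noteq> 0" using s by (auto simp: w_def)
  have eq: "1 / 2 * (q powi (int m)\<^sup>2 * w powi int m + q powi (- int m)\<^sup>2 * w powi (- int m)) =
      s ^ m * q ^ (m\<^sup>2) * cos (2 * of_nat m * v)" for m
  proof -
    have "w ^ m = s ^ m * exp (\<i> * (2 * of_nat m * v))"
      unfolding w_def power_mult_distrib exp_of_nat_mult[symmetric] by (simp add: mult_ac)
    moreover have "inverse (w ^ m) = s ^ m * exp (- (\<i> * (2 * of_nat m * v)))"
      unfolding calculation using s by (cases "even m") (auto simp: exp_minus)
    ultimately show ?thesis
      unfolding power_int_minus power_int_of_nat power2_minus cos_exp_eq
      by (simp only: power_int_of_nat flip: of_nat_power) (simp add: algebra_simps)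
  qed
  have "((\<lambda>n. 1 / 2 * (q powi (int (Suc n))\<^sup>2 * w powi int (Suc n) + q powi (- int (Suc n))\<^sup>2 * w powi (- int (Suc n)))) has_sum
       1 / 2 * (jtheta q w - q powi 0\<^sup>2 * w powi 0)) UNIV"
    by (intro has_sum_cmult_right has_sum_int_imp_nat jtheta_has_sum q \<open>w \<noteq> 0\<close>)
  then have "(\<lambda>n. s ^ Suc n * q ^ ((Suc n)\<^sup>2) * cos (2 * of_nat (Suc n) * v)) sums (1 / 2 * (jtheta q w - 1))"
    unfolding eq by (intro has_sum_imp_sums) simp
  note sum = sums_unique[OF this, symmetric]
  show ?thesis
    unfolding w_def[symmetric] sum by (simp add: field_simps)
qed

lemma theta3_eq_jtheta:
  assumes "Im \<tau> > 0"
  shows "theta3 \<tau> v = jtheta (nome \<tau>) (exp (2 * \<i> * v))"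
  using theta_nat_sum[OF nome_nz norm_nome_less_1[OF assms], of 1 v] by (simp add: theta3_def)

lemma theta4_eq_jtheta:
  assumes "Im \<tau> > 0"
  shows "theta4 \<tau> v = jtheta (nome \<tau>) (- exp (2 * \<i> * v))"
  using theta_nat_sum[OF nome_nz norm_nome_less_1[OF assms], of "- 1" v] by (simp add: theta4_def)

lemma jtheta_one_nz:
  assumes "q \<noteq> 0" "norm q < 1"
  shows "jtheta q 1 \<noteq> 0"
  using jtheta_nz[of q "- 1"] assms by simp

lemma DN_eq_dn_theta:
  assumes "Im \<tau> > 0"
  shows "DN z \<tau> = dn_theta (nome \<tau>) (exp (2 * \<i> * of_real pi * z))"
proof -
  have nz: "jtheta (nome \<tau>) 1 \<noteq> 0"
    using assms nome_nz norm_nome_less_1 jtheta_one_nz by blast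
  have K: "ell_K \<tau> = of_real pi / 2 * (jtheta (nome \<tau>) 1)\<^sup>2"
    using theta3_eq_jtheta[OF assms, of 0] by (simp add: ell_K_def)
  \<comment> \<open>\<open>jacobi_dn\<close> divides its argument by 2 K again, so K must be nonzero
    for z to be recovered.\<close>
  have "ell_K \<tau> \<noteq> 0" unfolding K using nz by simp
  then have u: "2 * ell_K \<tau> * z / (2 * ell_K \<tau>) = z" by simp
  have "2 * ell_K \<tau> / of_real pi = (jtheta (nome \<tau>) 1)\<^sup>2" unfolding K by simp
  then show ?thesis
    unfolding DN_def jacobi_dn_def u theta3_eq_jtheta[OF assms] theta4_eq_jtheta[OF assms] dn_theta_def
    using nz by (simp add: power2_eq_square mult.assoc)
qed

lemma dn_series_eq_dn_theta:
  assumes "q \<noteq> 0" "norm q < 1" "w \<noteq> 0" "norm (q * w) < 1" "norm (q / w) < 1"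
  shows "dn_series q w = dn_theta q w"
  using dn_series_theta[OF assms] jtheta_nz[OF assms] by (simp add: dn_theta_def eq_divide_eq)

text \<open>Numerator and denominator acquire the factors 1 / (q w) and 1 / (-q w), whose quotient
  is -1.\<close>

lemma dn_theta_shift:
  assumes "q \<noteq> 0" "norm q < 1" "w \<noteq> 0"
  shows "dn_theta q (q\<^sup>2 * w) = - dn_theta q w"
proof -
  have "jtheta q (q\<^sup>2 * u) = jtheta q u / (q * u)" if "u \<noteq> 0" for u
    using jtheta_quasi_period[OF assms(1,2) that] assms that by (simp add: eq_divide_eq mult.commute)
  from this[of w] this[of "- w"] show ?thesis using assms by (simp add: dn_theta_def)
qed

lemma dn_sec_term_shift:
  assumes "\<tau> \<noteq> 0"
  shows "dn_sec_term \<tau> (z + \<tau>) n = - dn_sec_term \<tau> z n"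
proof -
  have "(of_nat n + 1 / 2) * of_real pi * (2 * (z + \<tau>) - 1) / \<tau> =
     (of_nat n + 1 / 2) * of_real pi * (2 * z - 1) / \<tau> + (of_nat (2 * n + 1) * of_real pi)"
    using assms by (simp add: field_simps)
  moreover have "cos (u + of_nat (2 * n + 1) * of_real pi) = - cos u" for u :: complex
  proof -
    have e: "of_nat (2 * n + 1) * of_real pi = (of_real (real (2 * n + 1) * pi) :: complex)" by simp
    show ?thesis
      unfolding e cos_add cos_of_real sin_of_real sin_npi cos_npi by simp
  qed
  ultimately show ?thesis by (simp only: dn_sec_term_def) simp
qed

text \<open>The closed range of \<beta> matters: its translates by integers cover the real line,
  while those of the open range do not.\<close>

lemma dn_sec_sum_central:
  fixes a \<beta> :: real
  assumes \<tau>: "Im \<tau> > 0" and a: "0 < a" "a < 1" and \<beta>: "\<bar>\<beta>\<bar> \<le> 1 / 2"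
    and z: "z = of_real a + of_real \<beta> * \<tau>"
  shows "2 / \<tau> * (\<Sum>n. dn_sec_term \<tau> z n) = dn_theta (nome \<tau>) (exp (2 * \<i> * of_real pi * z))"
proof -
  define q where "q = nome \<tau>"
  have q: "q \<noteq> 0" "norm q < 1" using nome_nz norm_nome_less_1[OF \<tau>] by (simp_all add: q_def)
  define zz where "zz b = of_real a + of_real b * \<tau>" for b :: real
  define W where "W b = exp (2 * \<i> * of_real pi * zz b)" for b
  define c where "c = jtheta q 1 * jtheta q (- 1)"
  have c: "c \<noteq> 0" using jtheta_one_nz[OF q] jtheta_minus_one_nz[OF q] by (simp add: c_def)
  \<comment> \<open>The denominator is cleared so that \<open>h\<close> is continuous up to b =
    +-1/2, where nothing is yet known about the zeros of \<open>jtheta q (- W b)\<close>.\<close>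
  define h where "h b = 2 / \<tau> * (\<Sum>n. dn_sec_term \<tau> (zz b) n) * jtheta q (- W b) - c * jtheta q (W b)" for b
  have inner: "h b = 0" if "b \<in> {-1/2<..<1/2}" for b
  proof -
    have b: "\<bar>b\<bar> < 1 / 2" using that by (auto simp: abs_if)
    note n = norm_nome_exp_less_1[OF \<tau> zz_def b, folded W_def q_def]
    have "dn_series q (W b) = 2 / \<tau> * (\<Sum>n. dn_sec_term \<tau> (zz b) n)"
      using dn_series_eq_sec_sum[OF \<tau> a b zz_def[of b]] n q(2) by (simp add: q_def W_def nome_def)
    moreover have "dn_series q (W b) * jtheta q (- W b) = c * jtheta q (W b)"
      unfolding c_def by (rule dn_series_theta[OF q _ n]) (simp add: W_def)
    ultimately show ?thesis by (simp add: h_def)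
  qed
  have cont: "continuous_on (closure {-1/2<..<1/2}) h"
  proof -
    define I where "I = closure {-1/2<..<1/2::real}"
    have I: "I = {-1/2..1/2}" by (simp add: I_def)
    have "continuous_on I (\<lambda>b. infsum (\<lambda>n. dn_sec_term \<tau> (zz b) n) UNIV)"
    proof (rule continuous_on_infsum)
      show "norm (dn_sec_term \<tau> (zz b) n) \<le> (exp (pi * a * Im (1 / \<tau>)) ^ n + exp (pi * (1 - a) * Im (1 / \<tau>)) ^ n) / (1 - exp (pi * Im (1 / \<tau>)))" for n b
        by (rule norm_dn_sec_term_le[OF \<tau> a zz_def])
      have "0 \<le> (exp (pi * a * Im (1 / \<tau>)) ^ n + exp (pi * (1 - a) * Im (1 / \<tau>)) ^ n) / (1 - exp (pi * Im (1 / \<tau>)))" for n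
        by (rule order_trans[OF norm_ge_zero norm_dn_sec_term_le[OF \<tau> a zz_def[of 0]]])
      then show "(\<lambda>n. (exp (pi * a * Im (1 / \<tau>)) ^ n + exp (pi * (1 - a) * Im (1 / \<tau>)) ^ n) / (1 - exp (pi * Im (1 / \<tau>)))) summable_on UNIV"
        using dn_sec_majorant_summable[OF \<tau> a] by (subst summable_on_UNIV_nonneg_real_iff) auto
      show "continuous_on I (\<lambda>b. dn_sec_term \<tau> (zz b) n)" for n
        unfolding dn_sec_term_def zz_def divide_inverse by (intro continuous_intros)
    qed
    moreover have "infsum (\<lambda>n. dn_sec_term \<tau> (zz b) n) UNIV = (\<Sum>n. dn_sec_term \<tau> (zz b) n)" for b
    proof -
      have sn: "summable (\<lambda>n. norm (dn_sec_term \<tau> (zz b) n))"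
        by (rule summable_comparison_test'[OF dn_sec_majorant_summable[OF \<tau> a]])
           (simp only: real_norm_def abs_norm_cancel norm_dn_sec_term_le[OF \<tau> a zz_def])
      have "((\<lambda>n. dn_sec_term \<tau> (zz b) n) has_sum (\<Sum>n. dn_sec_term \<tau> (zz b) n)) UNIV"
        by (rule norm_summable_imp_has_sum[OF sn summable_sums[OF summable_norm_cancel[OF sn]]])
      then show ?thesis by (rule infsumI)
    qed
    ultimately have sec: "continuous_on I (\<lambda>b. \<Sum>n. dn_sec_term \<tau> (zz b) n)" by simp
    \<comment> \<open>|W b| = exp (-2 pi b Im \<tau>), so |b| <= 1/2 keeps W b in the closed annulus
      of radii 1/R and R.\<close>
    define R where "R = exp (pi * Im \<tau>)"
    have Wr: "1 / R \<le> norm (W b) \<and> norm (W b) \<le> R" if "b \<in> I" for b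
    proof -
      have "norm (W b) = exp (- (pi * Im \<tau> * (2 * b)))"
        unfolding W_def by (rule norm_exp_2pii[OF zz_def])
      moreover have "pi * Im \<tau> * (2 * b) \<le> pi * Im \<tau> * 1" "pi * Im \<tau> * (- (2 * b)) \<le> pi * Im \<tau> * 1"
        using that \<tau> by (intro mult_left_mono; simp add: I)+
      ultimately show ?thesis by (simp add: R_def exp_minus[symmetric] inverse_eq_divide[symmetric])
    qed
    have W: "continuous_on I W" unfolding W_def zz_def by (intro continuous_intros)
    have th: "continuous_on {w. 1 / R \<le> norm w \<and> norm w \<le> R} (jtheta q)"
      by (rule continuous_on_jtheta[OF q]) (simp add: R_def)
    have "continuous_on I (\<lambda>b. jtheta q (W b))" "continuous_on I (\<lambda>b. jtheta q (- W b))"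
      by (rule continuous_on_compose2[OF th]; use Wr in \<open>auto intro!: continuous_intros W\<close>)+
    with sec show ?thesis unfolding h_def[abs_def] I_def[symmetric] by (intro continuous_intros)
  qed
  have "\<beta> \<in> closure {-1/2<..<1/2::real}" using \<beta> by (simp add: abs_if split: if_splits)
  then have "h \<beta> = 0"
    using continuous_constant_on_closure[OF cont] inner by blast
  (* By the identity just obtained both theta values could vanish only together, and then their sum,
     a theta value for 4 * tau well inside its strip, would vanish too. *)
  moreover have "jtheta q (- W \<beta>) \<noteq> 0"
  proof
    assume 0: "jtheta q (- W \<beta>) = 0"
    with \<open>h \<beta> = 0\<close> c have "jtheta q (W \<beta>) = 0" by (simp add: h_def)
    with 0 have "jtheta (q ^ 4) ((W \<beta>)\<^sup>2) = 0"
      using jtheta_plus_minus[OF q, of "W \<beta>"] by (simp add: W_def)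
    \<comment> \<open>Squaring W doubles a + \<beta> \<tau> into 2 a + (\<beta>/2) (4 \<tau>), so
      the new coordinate satisfies |\<beta>/2| <= 1/4. The extra 1/2 cancels the minus sign in the
      form in which \<open>jtheta_nz\<close> is stated.\<close>
    moreover have "jtheta (nome (4 * \<tau>)) (- exp (2 * \<i> * of_real pi * (of_real (2 * a + 1 / 2) + of_real (\<beta> / 2) * (4 * \<tau>)))) \<noteq> 0"
      using norm_nome_less_1[of "4 * \<tau>"] norm_nome_exp_less_1[of "4 * \<tau>" _ "2 * a + 1 / 2" "\<beta> / 2"] \<tau> \<beta>
      by (intro jtheta_nz nome_nz) (simp_all)
    moreover have "nome (4 * \<tau>) = q ^ 4"
      unfolding q_def nome_def exp_of_nat_mult[symmetric] by (simp add: mult_ac)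
    moreover have "- exp (2 * \<i> * of_real pi * (of_real (2 * a + 1 / 2) + of_real (\<beta> / 2) * (4 * \<tau>))) = (W \<beta>)\<^sup>2"
    proof -
      have "2 * \<i> * of_real pi * (of_real (2 * a + 1 / 2) + of_real (\<beta> / 2) * (4 * \<tau>)) = of_nat 2 * (2 * \<i> * of_real pi * zz \<beta>) + \<i> * of_real pi"
        by (simp add: zz_def algebra_simps)
      then show ?thesis unfolding W_def exp_of_nat_mult[symmetric] by (simp only: exp_add) simp
    qed
    ultimately show False by simp
  qed
  ultimately have "2 / \<tau> * (\<Sum>n. dn_sec_term \<tau> (zz \<beta>) n) = c * jtheta q (W \<beta>) / jtheta q (- W \<beta>)"
    by (simp add: h_def eq_divide_eq)
  then show ?thesis
    by (simp add: dn_theta_def c_def q_def W_def zz_def z)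
qed

lemma dn_sec_sum:
  fixes a \<beta> :: real
  assumes \<tau>: "Im \<tau> > 0" and a: "0 < a" "a < 1" and z: "z = of_real a + of_real \<beta> * \<tau>"
  shows "2 / \<tau> * (\<Sum>n. dn_sec_term \<tau> z n) = dn_theta (nome \<tau>) (exp (2 * \<i> * of_real pi * z))"
proof -
  have \<tau>0: "\<tau> \<noteq> 0" using \<tau> by auto
  define P where "P u \<longleftrightarrow> 2 / \<tau> * (\<Sum>n. dn_sec_term \<tau> u n) = dn_theta (nome \<tau>) (exp (2 * \<i> * of_real pi * u))" for u
  have shift: "P (u + \<tau>) \<longleftrightarrow> P u" if "summable (dn_sec_term \<tau> u)" for u
  proof -
    have "(\<Sum>n. dn_sec_term \<tau> (u + \<tau>) n) = - (\<Sum>n. dn_sec_term \<tau> u n)"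
      unfolding dn_sec_term_shift[OF \<tau>0] using that by (rule suminf_minus)
    moreover have "exp (2 * \<i> * of_real pi * (u + \<tau>)) = (nome \<tau>)\<^sup>2 * exp (2 * \<i> * of_real pi * u)"
      unfolding nome_def exp_of_nat_mult[symmetric] exp_add[symmetric] by (simp add: algebra_simps)
    ultimately show ?thesis
      using dn_theta_shift[OF nome_nz norm_nome_less_1[OF \<tau>], of "exp (2 * \<i> * of_real pi * u)"]
      by (simp add: P_def)
  qed
  \<comment> \<open>Rounding leaves |\<beta>0| <= 1/2, where equality can occur; the remaining
    integer multiple of \<tau> is removed step by step, both sides changing sign each time.\<close>
  define \<beta>0 where "\<beta>0 = \<beta> - of_int (round \<beta>)"
  define u where "u k = of_real a + of_real (\<beta>0 + of_int k) * \<tau>" for k :: int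
  have sum: "summable (dn_sec_term \<tau> (u k))" for k
    by (rule dn_sec_summable[OF \<tau> a u_def])
  have step: "P (u (k + 1)) \<longleftrightarrow> P (u k)" for k
    using shift[OF sum[of k]] by (simp add: u_def algebra_simps)
  have "P (u 0)"
    unfolding P_def using of_int_round_abs_le[of \<beta>]
    by (intro dn_sec_sum_central[OF \<tau> a _ u_def]) (simp add: \<beta>0_def abs_minus_commute)
  have "P (u k)" for k
  proof (induction k rule: int_induct[where k = 0])
    case (step2 i)
    then show ?case using step[of "i - 1"] by simp
  qed (use \<open>P (u 0)\<close> step in auto)
  then have "P (u (round \<beta>))" .
  then show ?thesis by (simp add: P_def u_def \<beta>0_def z)
qed

theorem mainTheorem4:
  fixes \<tau> q z :: complex and \<alpha> \<beta> :: real
  assumes "Im \<tau> > 0"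
    and "q = nome \<tau>"
    and "z = 1 / 2 + of_real \<alpha> + of_real \<beta> * \<tau>"
  shows "(\<bar>\<beta>\<bar> < 1 / 2 \<longrightarrow>
           summable (\<lambda>n. q ^ Suc n * cos (2 * of_nat (Suc n) * of_real pi * z) / (1 + q ^ (2 * Suc n))) \<and>
           DN z \<tau> = 1 + 4 * (\<Sum>n. q ^ Suc n * cos (2 * of_nat (Suc n) * of_real pi * z) / (1 + q ^ (2 * Suc n))) \<and>
           summable (\<lambda>n. cos (2 * of_nat (Suc n) * of_real pi * z) / cos (of_nat (Suc n) * of_real pi * \<tau>)) \<and>
           DN z \<tau> = 1 + 2 * (\<Sum>n. cos (2 * of_nat (Suc n) * of_real pi * z) / cos (of_nat (Suc n) * of_real pi * \<tau>))) \<and>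
         (\<bar>\<alpha>\<bar> < 1 / 2 \<longrightarrow>
           summable (\<lambda>n. (-1) ^ n * cos ((of_nat n + 1 / 2) * of_real pi * (2 * z - 1) / \<tau>)
                           / sin ((of_nat n + 1 / 2) * of_real pi / \<tau>)) \<and>
           DN z \<tau> = 2 / \<tau> * (\<Sum>n. (-1) ^ n * cos ((of_nat n + 1 / 2) * of_real pi * (2 * z - 1) / \<tau>)
                           / sin ((of_nat n + 1 / 2) * of_real pi / \<tau>)))"
proof (intro conjI impI)
  \<comment> \<open>The coordinate a of the preceding lemmas is 1/2 + \<alpha>, so |\<alpha>| < 1/2
    means 0 < a < 1.\<close>
  have z: "z = of_real (1 / 2 + \<alpha>) + of_real \<beta> * \<tau>"
    using assms(3) by simp
  note DN = DN_eq_dn_theta[OF assms(1), of z]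
  {
    assume \<beta>: "\<bar>\<beta>\<bar> < 1 / 2"
    have q: "q \<noteq> 0" "norm q < 1"
      using nome_nz norm_nome_less_1[OF assms(1)] by (simp_all add: assms(2))
    define w where "w = exp (2 * \<i> * of_real pi * z)"
    have w: "w \<noteq> 0" "norm (q * w) < 1" "norm (q / w) < 1"
      using norm_nome_exp_less_1[OF assms(1) z \<beta>] by (simp_all add: w_def assms(2))
    have dn_term: "2 * q ^ m * (w ^ m + 1 / w ^ m) / (1 + q ^ (2 * m)) =
        4 * (q ^ m * cos (2 * of_nat m * of_real pi * z) / (1 + q ^ (2 * m)))" for m
    proof -
      have "w ^ m = exp (\<i> * (2 * of_nat m * of_real pi * z))"
        unfolding w_def exp_of_nat_mult[symmetric] by (simp add: mult_ac)
      then have "w ^ m + 1 / w ^ m = 2 * cos (2 * of_nat m * of_real pi * z)"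
        by (simp add: cos_exp_eq exp_minus inverse_eq_divide)
      then show ?thesis by simp
    qed
    have cos_term: "cos (2 * of_nat m * of_real pi * z) / cos (of_nat m * of_real pi * \<tau>) =
        2 * (q ^ m * cos (2 * of_nat m * of_real pi * z) / (1 + q ^ (2 * m)))" for m
    proof -
      have "q ^ m = exp (\<i> * (of_nat m * of_real pi * \<tau>))"
        unfolding assms(2) nome_def exp_of_nat_mult[symmetric] by (simp add: mult_ac)
      from sec_exp[OF disjI1[OF this]]
      have "1 / cos (of_nat m * of_real pi * \<tau>) = 2 * (q ^ m / (1 + q ^ (2 * m)))"
        by (simp add: mult.commute flip: power_mult)
      then have "cos (2 * of_nat m * of_real pi * z) * (1 / cos (of_nat m * of_real pi * \<tau>)) =
         cos (2 * of_nat m * of_real pi * z) * (2 * (q ^ m / (1 + q ^ (2 * m))))" by simp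
      then show ?thesis by (simp add: mult_ac)
    qed
    have "(\<lambda>n. 1 / 4 * (4 * (q ^ Suc n * cos (2 * of_nat (Suc n) * of_real pi * z) / (1 + q ^ (2 * Suc n))))) sums (1 / 4 * (dn_series q w - 1))"
      by (intro sums_mult has_sum_imp_sums) (rule dn_series_nat_sum[OF q w, unfolded dn_term])
    then have s1: "(\<lambda>n. q ^ Suc n * cos (2 * of_nat (Suc n) * of_real pi * z) / (1 + q ^ (2 * Suc n))) sums (1 / 4 * (DN z \<tau> - 1))"
      using dn_series_eq_dn_theta[OF q w] by (simp add: DN w_def assms(2))
    have s2: "(\<lambda>n. cos (2 * of_nat (Suc n) * of_real pi * z) / cos (of_nat (Suc n) * of_real pi * \<tau>)) sums (2 * (1 / 4 * (DN z \<tau> - 1)))"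
      unfolding cos_term by (intro sums_mult s1)
    show "summable (\<lambda>n. q ^ Suc n * cos (2 * of_nat (Suc n) * of_real pi * z) / (1 + q ^ (2 * Suc n)))"
      using s1 by (rule sums_summable)
    show "DN z \<tau> = 1 + 4 * (\<Sum>n. q ^ Suc n * cos (2 * of_nat (Suc n) * of_real pi * z) / (1 + q ^ (2 * Suc n)))"
      unfolding sums_unique[OF s1, symmetric] by (simp add: field_simps)
    show "summable (\<lambda>n. cos (2 * of_nat (Suc n) * of_real pi * z) / cos (of_nat (Suc n) * of_real pi * \<tau>))"
      using s2 by (rule sums_summable)
    show "DN z \<tau> = 1 + 2 * (\<Sum>n. cos (2 * of_nat (Suc n) * of_real pi * z) / cos (of_nat (Suc n) * of_real pi * \<tau>))"
      unfolding sums_unique[OF s2, symmetric] by (simp add: field_simps)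
  next
    assume "\<bar>\<alpha>\<bar> < 1 / 2"
    then have a: "0 < 1 / 2 + \<alpha>" "1 / 2 + \<alpha> < 1" by linarith+
    show "summable (\<lambda>n. (-1) ^ n * cos ((of_nat n + 1 / 2) * of_real pi * (2 * z - 1) / \<tau>)
                           / sin ((of_nat n + 1 / 2) * of_real pi / \<tau>))"
      using dn_sec_summable[OF assms(1) a z] unfolding dn_sec_term_def[abs_def] .
    show "DN z \<tau> = 2 / \<tau> * (\<Sum>n. (-1) ^ n * cos ((of_nat n + 1 / 2) * of_real pi * (2 * z - 1) / \<tau>)
                           / sin ((of_nat n + 1 / 2) * of_real pi / \<tau>))"
      using dn_sec_sum[OF assms(1) a z] unfolding DN dn_sec_term_def[abs_def] by (rule sym)
  }
qed

end
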